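(* Let $P=\{p,q\}$ be a matched pair and let $D=D_1\otimes\cdots\otimes D_n$ be a viable tensor product of diagrams on the fragment $\mathcal{Z}_P$. Then, after possibly exchanging the names $p,q$, $D$ is an extension-contraction of one of the following tensor products, and the H-data (occupation of $P$ and on/off status) and tightness of $D$ are as listed for it: - unoccupied 00: tight: $e_0$. - unoccupied 11: tight: $e_1$. - pre-one-half-occupied 01: tight: $p_-$. - post-one-half-occupied 10: tight: $p_+$. - alternately occupied 00: singular: $q_-\otimes p_+$. - alternately occupied 11: tight: $p_+\otimes q_-$. - once occupied 00: tight: $p_-\otimes p_+$. - once occupied 11: twisted: $p_+\otimes p_-$; crossed: $c_p$. - pre-sesqui-occupied 01: tight: $p_-\otimes p_+\otimes q_-$; sublime: $q_-\otimes c_p$; critical: $q_-\otimes p_+\otimes p_-$. - post-sesqui-occupied 10: tight: $q_+\otimes p_-\otimes p_+$; sublime: $c_p\otimes q_+$; critical: $p_+\otimes p_-\otimes q_+$. - doubly occupied 00: tight: $p_-\otimes p_+\otimes q_-\otimes q_+$; sublime: $p_-\otimes c_q\otimes p_+$; critical: $p_-\otimes q_+\otimes q_-\otimes p_+$. - doubly occupied 11: tight: $p_+\otimes q_-\otimes q_+\otimes p_-$; sublime: $c_q\otimes p_+\otimes p_-$ and $p_+\otimes p_-\otimes c_q$; crossed: $c_p\otimes c_q$; critical: $p_+\otimes p_-\otimes q_+\otimes q_-$. (A given $D$ may be an extension-contraction of more than one of these: a contraction of a sublime tensor product may coincide with a contraction of a tight one.)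
   Context: All algebra is over $\mathbb{Z}_2$. The fragment $\mathcal{Z}_P$ is the arc diagram with two oriented intervals, one containing a single place $p$ in its interior and the other a single place $q$, with one matched pair $P=\{p,q\}$. Write $-\infty_p,+\infty_p$ and $-\infty_q,+\infty_q$ for the start and end points of the intervals through $p$ and $q$; the four steps are the parts before and after each place. Let $\mathbf{a}=\{p,q\}$, $E=\{\pm\infty_p,\pm\infty_q\}$. A strand diagram is $(S,T,\phi)$ with $S,T\subseteq\mathbf{a}\cup E$ and $\phi:S\to T$ a bijection with $\phi(x)\ge x$ along the intervals ($x$ and $\phi(x)$ on the same interval), thought of as strands $x\to\phi(x)$; crossings are inversions. The product of $(S,T,\phi)$ and $(U,V,\psi)$ is $(S,V,\psi\phi)$ if $T=U$ and $\mathrm{inv}(\psi\phi)=\mathrm{inv}(\phi)+\mathrm{inv}(\psi)$, else $0$; $\partial$ is the sum of all resolutions of one crossing lowering the number of crossings by exactly $1$. For $s\subseteq\{P\}$ let $I(s)=\sum_S I(S)$ (identity diagrams), over $S$ consisting of exactly one of $p,q$ if $P\in s$ (none if $P\notin s$) and any subset of $E$. For $\mu=(S,T,\phi)$ without fixed points let $a(\mu)=\sum_U(S\cup U,T\cup U,\phi_U)$ over $U\subseteq(\mathbf{a}\cup E)\setminus(S\cup T)$, $\phi_U$ extending $\phi$ by the identity. A diagram from $s$ to $t$ is a nonzero element $I(s)a(\mu)I(t)$; it is described by the strands of $\mu$ together with, when horizontal strands at $P$ occur, a dotted pair of horizontal strands at $p$ and $q$ (standing for the sum of the two choices). The strand algebra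 $\mathcal{A}=\mathcal{A}(\mathcal{Z}_P)$ is the DGA with basis the diagrams. The H-data of a diagram from $s$ to $t$ is $(h,s,t)$, $h$ being the sum of $[x,\phi(x)]$ (which steps are covered); $\mathcal{A}(h,s,t)$ is the span of diagrams with H-data $(h,s,t)$. $D_1\otimes\cdots\otimes D_n$, with $D_i$ having H-data $(h_i,s_i,t_i)$, is viable if $t_i=s_{i+1}$ for all $i$ and $h=\sum h_i$ covers each step at most once; its H-data is $(h,s_1,t_n)$. Terminology for H-data $(h,s,t)$: $P$ is 00, 01, 10, 11, the first digit being $1$ iff $P\in s$, the second $1$ iff $P\in t$. A place is unoccupied if neither adjacent step is covered by $h$, pre-half-occupied (post-half-occupied) if only the step before (after) it is covered, half-occupied in either of these cases, fully occupied if both are. $P$ is: unoccupied if both places are; (pre-/post-)one-half-occupied if one place is (pre-/post-)half-occupied and the other unoccupied; alternately occupied if both are half-occupied; once occupied if one is fully occupied and the other unoccupied; (pre-/post-)sesqui-occupied if one is fully occupied and the other (pre-/post-)half-occupied; doubly occupied if both are fully occupied. Named diagrams: $e_0$: no strands; $e_1$: dotted horizontal pair only; $p_-$: one strand $-\infty_p\to p$; $p_+$: one strand $p\to+\infty_p$; $c_p$: a strand $-\infty_p\to+\infty_p$ and the dotted horizontal pair; similarly $q_\pm$, $c_q$. Tightness: a diagram is tight if it has no crossings and is nonzero in homology, twisted if it has no crossings and is zero in homology, crossed if it has crossings. A viable $D=D_1\otimes\cdots\otimes D_n$ with H-data $(h,s,t)$ is: tight if $D_1\cdots D_n$ is nonzero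 and tight and all $D_i$ are tight; sublime if $D_1\cdots D_n$ is nonzero and tight but not all $D_i$ are tight; twisted (crossed) if $D_1\cdots D_n$ is nonzero and twisted (crossed); critical if $D_1\cdots D_n=0$ but $\mathcal{A}(h,s,t)\ne0$; singular if $\mathcal{A}(h,s,t)=0$. An extension of a viable $D_1\otimes\cdots\otimes D_n$ inserts, at some position (possibly at either end), the idempotent diagram ($e_0$ or $e_1$) matching the idempotents at that position. A contraction replaces a sub-product $D_i\otimes\cdots\otimes D_j$ by the single factor $D_i\cdots D_j$, provided this product is nonzero. An extension-contraction is the result of any finite (possibly empty) sequence of extensions and contractions. *)

theory Defs
  imports Complex_Main "HOL-Library.Z2" "HOL-Library.Function_Algebras"
begin

text \<open>
  The fragment \<open>Z_P\<close>. A value of type \<open>place\<close> names one of the two places as well as the interval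
  through it: \<open>NegInf x\<close>, \<open>At x\<close>, \<open>PosInf x\<close> are the start point, the place and the end point of
  the interval through \<open>x\<close>.
\<close>

datatype place = PlaceP | PlaceQ

datatype point = NegInf place | At place | PosInf place

instance point :: finite
proof
  have "x \<in> {NegInf PlaceP, NegInf PlaceQ, At PlaceP, At PlaceQ, PosInf PlaceP, PosInf PlaceQ}" for x
    by (cases x; rename_tac y; case_tac y) simp_all
  then have "UNIV \<subseteq> {NegInf PlaceP, NegInf PlaceQ, At PlaceP, At PlaceQ, PosInf PlaceP, PosInf PlaceQ}"
    by (intro subsetI)
  then show "finite (UNIV :: point set)"
    by (rule finite_subset) (intro finite.intros)
qed

fun interval :: "point \<Rightarrow> place" where
  "interval (NegInf x) = x"
| "interval (At x) = x"
| "interval (PosInf x) = x"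

fun height :: "point \<Rightarrow> nat" where
  "height (NegInf x) = 0"
| "height (At x) = 1"
| "height (PosInf x) = 2"

definition point_le :: "point \<Rightarrow> point \<Rightarrow> bool" (infix "\<preceq>" 50) where
  "x \<preceq> y \<longleftrightarrow> interval x = interval y \<and> height x \<le> height y"

definition point_less :: "point \<Rightarrow> point \<Rightarrow> bool" (infix "\<prec>" 50) where
  "x \<prec> y \<longleftrightarrow> interval x = interval y \<and> height x < height y"

datatype step = Before place | After place

fun step_start :: "step \<Rightarrow> point" where
  "step_start (Before x) = NegInf x"
| "step_start (After x) = At x"

fun step_end :: "step \<Rightarrow> point" where
  "step_end (Before x) = At x"
| "step_end (After x) = PosInf x"


section \<open>Strand diagrams and their formal sums\<close>

text \<open>
  A strand diagram \<open>(S, T, \<phi>)\<close> is its set of strands, i.e. the graph of \<open>\<phi>\<close>, so that \<open>S\<close> and \<open>T\<close>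
  are the domain and the range of this relation. The graph of \<open>\<psi>\<phi>\<close> is \<open>\<phi> O \<psi>\<close>.
\<close>

type_synonym strand_diagram = "(point \<times> point) set"

definition strand_diagrams :: "strand_diagram set" where
  "strand_diagrams =
     {d. single_valued d \<and> single_valued (d\<inverse>) \<and> (\<forall>(x, y)\<in>d. x \<preceq> y)}"

text \<open>The strand starting lower comes first, so every crossing is listed once.\<close>

definition crossings :: "strand_diagram \<Rightarrow> ((point \<times> point) \<times> (point \<times> point)) set" where
  "crossings d = {(a, b). a \<in> d \<and> b \<in> d \<and> fst a \<prec> fst b \<and> snd b \<prec> snd a}"

definition inv_count :: "strand_diagram \<Rightarrow> nat" where
  "inv_count d = card (crossings d)"

fun resolve :: "strand_diagram \<Rightarrow> (point \<times> point) \<times> (point \<times> point) \<Rightarrow> strand_diagram" where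
  "resolve d (a, b) = (d - {a, b}) \<union> {(fst a, snd b), (fst b, snd a)}"

text \<open>
  Formal \<open>\<int>/2\<close>-linear combinations of strand diagrams, as coefficient functions with values in the
  field \<open>bit\<close> of two elements; \<open>0\<close>, \<open>+\<close> and sums are pointwise. The pointwise \<open>*\<close> that comes with
  \<open>Function_Algebras\<close> is not the product of the algebra, which is \<open>\<odot>\<close> below.
\<close>

type_synonym element = "strand_diagram \<Rightarrow> bit"

definition single :: "strand_diagram \<Rightarrow> element" where
  "single d = (\<lambda>f. if f = d then 1 else 0)"

definition scale :: "bit \<Rightarrow> element \<Rightarrow> element" where
  "scale c a = (\<lambda>d. c * a d)"

interpretation strand: vector_space scale
  by unfold_locales
    (rule ext, simp only: scale_def plus_fun_def distrib_left distrib_right mult.assoc mult_1_left)+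

definition sd_mult :: "strand_diagram \<Rightarrow> strand_diagram \<Rightarrow> element" where
  "sd_mult d e =
     (if Range d = Domain e \<and> inv_count (d O e) = inv_count d + inv_count e
      then single (d O e) else 0)"

definition mult :: "element \<Rightarrow> element \<Rightarrow> element" (infixl "\<odot>" 70) where
  "a \<odot> b = (\<Sum>d\<in>strand_diagrams. \<Sum>e\<in>strand_diagrams. scale (a d * b e) (sd_mult d e))"

definition sd_boundary :: "strand_diagram \<Rightarrow> element" where
  "sd_boundary d =
     (\<Sum>c\<in>{c \<in> crossings d. inv_count (resolve d c) + 1 = inv_count d}. single (resolve d c))"

definition boundary :: "element \<Rightarrow> element" where
  "boundary a = (\<Sum>d\<in>strand_diagrams. scale (a d) (sd_boundary d))"


section \<open>Diagrams and the strand algebra\<close>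

text \<open>Subsets \<open>s\<close> of \<open>{P}\<close> are represented by the truth value of \<open>P \<in> s\<close>.\<close>

definition idem :: "bool \<Rightarrow> element" where
  "idem s = (\<Sum>S\<in>{S. card (S \<inter> range At) = (if s then 1 else 0)}. single (Id_on S))"

definition a_elt :: "strand_diagram \<Rightarrow> element" where
  "a_elt \<mu> = (\<Sum>U\<in>{U. U \<inter> (Domain \<mu> \<union> Range \<mu>) = {}}. single (\<mu> \<union> Id_on U))"

definition diag :: "bool \<Rightarrow> strand_diagram \<Rightarrow> bool \<Rightarrow> element" where
  "diag s \<mu> t = idem s \<odot> a_elt \<mu> \<odot> idem t"

text \<open>\<open>covering \<mu>\<close> is the sum of the chains \<open>[x, \<phi>(x)]\<close>, given by its multiplicity at each step.\<close>

definition covering :: "strand_diagram \<Rightarrow> step \<Rightarrow> nat" where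
  "covering \<mu> z = card {(x, y). (x, y) \<in> \<mu> \<and> x \<preceq> step_start z \<and> step_end z \<preceq> y}"

type_synonym hdata = "(step \<Rightarrow> nat) \<times> bool \<times> bool"

definition has_hdata :: "element \<Rightarrow> hdata \<Rightarrow> bool" where
  "has_hdata D k \<longleftrightarrow>
     (\<exists>s \<mu> t. \<mu> \<in> strand_diagrams \<and> irrefl \<mu> \<and> D = diag s \<mu> t \<and> D \<noteq> 0 \<and> k = (covering \<mu>, s, t))"

definition is_diagram :: "element \<Rightarrow> bool" where
  "is_diagram D \<longleftrightarrow>
     (\<exists>s \<mu> t. \<mu> \<in> strand_diagrams \<and> irrefl \<mu> \<and> D = diag s \<mu> t \<and> D \<noteq> 0)"

text \<open>
  The H-data of a diagram is well defined: any term of \<open>diag s \<mu> t\<close> determines \<open>s\<close>, \<open>t\<close>, and \<open>\<mu>\<close> (its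
  non-horizontal strands).
\<close>

definition hdata_of :: "element \<Rightarrow> hdata" where
  "hdata_of D = (THE k. has_hdata D k)"

definition h_of :: "element \<Rightarrow> step \<Rightarrow> nat" where
  "h_of D = fst (hdata_of D)"

definition src :: "element \<Rightarrow> bool" where
  "src D = fst (snd (hdata_of D))"

definition tgt :: "element \<Rightarrow> bool" where
  "tgt D = snd (snd (hdata_of D))"

definition strand_algebra :: "element set" where
  "strand_algebra = strand.span {D. is_diagram D}"

definition summand :: "hdata \<Rightarrow> element set" where
  "summand k = strand.span {D. has_hdata D k}"

definition zero_in_homology :: "element \<Rightarrow> bool" where
  "zero_in_homology x \<longleftrightarrow> x \<in> boundary ` strand_algebra"

definition nonzero_in_homology :: "element \<Rightarrow> bool" where
  "nonzero_in_homology x \<longleftrightarrow>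
     x \<in> strand_algebra \<and> boundary x = 0 \<and> x \<notin> boundary ` strand_algebra"


section \<open>Tensor products of diagrams\<close>

text \<open>\<open>D\<^sub>1 \<otimes> \<dots> \<otimes> D\<^sub>n\<close> is the list of its factors.\<close>

definition viable :: "element list \<Rightarrow> bool" where
  "viable Ds \<longleftrightarrow>
     Ds \<noteq> [] \<and> (\<forall>D\<in>set Ds. is_diagram D) \<and>
     (\<forall>i. Suc i < length Ds \<longrightarrow> tgt (Ds ! i) = src (Ds ! Suc i)) \<and>
     (\<forall>z. (\<Sum>D\<leftarrow>Ds. h_of D z) \<le> 1)"

definition tensor_hdata :: "element list \<Rightarrow> hdata" where
  "tensor_hdata Ds = ((\<lambda>z. \<Sum>D\<leftarrow>Ds. h_of D z), src (hd Ds), tgt (last Ds))"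

text \<open>Only used for nonempty lists.\<close>

fun product :: "element list \<Rightarrow> element" where
  "product [] = undefined"
| "product [D] = D"
| "product (D # E # Ds) = D \<odot> product (E # Ds)"

text \<open>
  A diagram has a crossing if one of its terms does: \<open>diag True {(NegInf x, PosInf x)} True\<close> has one,
  between its strand and the dotted horizontal strand at \<open>x\<close>, although its terms with the horizontal
  strand at the other place have none.
\<close>

definition has_crossing :: "element \<Rightarrow> bool" where
  "has_crossing D \<longleftrightarrow> (\<exists>d\<in>strand_diagrams. D d \<noteq> 0 \<and> crossings d \<noteq> {})"

definition tight_diagram :: "element \<Rightarrow> bool" where
  "tight_diagram D \<longleftrightarrow> \<not> has_crossing D \<and> nonzero_in_homology D"

definition twisted_diagram :: "element \<Rightarrow> bool" where
  "twisted_diagram D \<longleftrightarrow> \<not> has_crossing D \<and> zero_in_homology D"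

datatype tightness = Tight | Sublime | Twisted | Crossed | Critical | Singular

fun has_tightness :: "element list \<Rightarrow> tightness \<Rightarrow> bool" where
  "has_tightness Ds Tight \<longleftrightarrow>
     product Ds \<noteq> 0 \<and> tight_diagram (product Ds) \<and> (\<forall>D\<in>set Ds. tight_diagram D)"
| "has_tightness Ds Sublime \<longleftrightarrow>
     product Ds \<noteq> 0 \<and> tight_diagram (product Ds) \<and> \<not> (\<forall>D\<in>set Ds. tight_diagram D)"
| "has_tightness Ds Twisted \<longleftrightarrow> product Ds \<noteq> 0 \<and> twisted_diagram (product Ds)"
| "has_tightness Ds Crossed \<longleftrightarrow> product Ds \<noteq> 0 \<and> has_crossing (product Ds)"
| "has_tightness Ds Critical \<longleftrightarrow> product Ds = 0 \<and> summand (tensor_hdata Ds) \<noteq> {0}"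
| "has_tightness Ds Singular \<longleftrightarrow> summand (tensor_hdata Ds) = {0}"

definition idem_diagram :: "bool \<Rightarrow> element" where
  "idem_diagram s = diag s {} s"

inductive ext_contr :: "element list \<Rightarrow> element list \<Rightarrow> bool" for L where
  refl: "ext_contr L L"
| extension: "ext_contr L (Xs @ Ys) \<Longrightarrow> Xs @ Ys \<noteq> [] \<Longrightarrow>
     (Xs \<noteq> [] \<longrightarrow> tgt (last Xs) = s) \<Longrightarrow> (Ys \<noteq> [] \<longrightarrow> src (hd Ys) = s) \<Longrightarrow>
     ext_contr L (Xs @ [idem_diagram s] @ Ys)"
| contraction: "ext_contr L (Xs @ Ys @ Zs) \<Longrightarrow> Ys \<noteq> [] \<Longrightarrow> product Ys \<noteq> 0 \<Longrightarrow>
     ext_contr L (Xs @ [product Ys] @ Zs)"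


section \<open>Occupation\<close>

definition unocc :: "(step \<Rightarrow> nat) \<Rightarrow> place \<Rightarrow> bool" where
  "unocc h x \<longleftrightarrow> h (Before x) = 0 \<and> h (After x) = 0"

definition pre_half :: "(step \<Rightarrow> nat) \<Rightarrow> place \<Rightarrow> bool" where
  "pre_half h x \<longleftrightarrow> h (Before x) \<noteq> 0 \<and> h (After x) = 0"

definition post_half :: "(step \<Rightarrow> nat) \<Rightarrow> place \<Rightarrow> bool" where
  "post_half h x \<longleftrightarrow> h (Before x) = 0 \<and> h (After x) \<noteq> 0"

definition half :: "(step \<Rightarrow> nat) \<Rightarrow> place \<Rightarrow> bool" where
  "half h x \<longleftrightarrow> pre_half h x \<or> post_half h x"

definition full :: "(step \<Rightarrow> nat) \<Rightarrow> place \<Rightarrow> bool" where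
  "full h x \<longleftrightarrow> h (Before x) \<noteq> 0 \<and> h (After x) \<noteq> 0"

datatype occupation = Unoccupied | PreOneHalf | PostOneHalf | Alternately | Once
  | PreSesqui | PostSesqui | Doubly

fun has_occupation :: "(step \<Rightarrow> nat) \<Rightarrow> occupation \<Rightarrow> bool" where
  "has_occupation h Unoccupied \<longleftrightarrow> (\<forall>x. unocc h x)"
| "has_occupation h PreOneHalf \<longleftrightarrow> (\<exists>x y. x \<noteq> y \<and> pre_half h x \<and> unocc h y)"
| "has_occupation h PostOneHalf \<longleftrightarrow> (\<exists>x y. x \<noteq> y \<and> post_half h x \<and> unocc h y)"
| "has_occupation h Alternately \<longleftrightarrow> (\<forall>x. half h x)"
| "has_occupation h Once \<longleftrightarrow> (\<exists>x y. x \<noteq> y \<and> full h x \<and> unocc h y)"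
| "has_occupation h PreSesqui \<longleftrightarrow> (\<exists>x y. x \<noteq> y \<and> full h x \<and> pre_half h y)"
| "has_occupation h PostSesqui \<longleftrightarrow> (\<exists>x y. x \<noteq> y \<and> full h x \<and> post_half h y)"
| "has_occupation h Doubly \<longleftrightarrow> (\<forall>x. full h x)"


section \<open>The list of tensor products\<close>

text \<open>\<open>pre p\<close>, \<open>post p\<close>, \<open>cr p\<close> are the diagrams \<open>p\<^sub>-\<close>, \<open>p\<^sub>+\<close>, \<open>c\<^sub>p\<close>.\<close>

definition pre :: "place \<Rightarrow> element" where
  "pre x = diag False {(NegInf x, At x)} True"

definition post :: "place \<Rightarrow> element" where
  "post x = diag True {(At x, PosInf x)} False"

definition cr :: "place \<Rightarrow> element" where
  "cr x = diag True {(NegInf x, PosInf x)} True"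

abbreviation "e0 \<equiv> idem_diagram False"
abbreviation "e1 \<equiv> idem_diagram True"

text \<open>An entry consists of the occupation of \<open>P\<close>, its two on/off digits, the tightness and the factors.\<close>

definition listed :: "place \<Rightarrow> place \<Rightarrow> (occupation \<times> bool \<times> bool \<times> tightness \<times> element list) set"
where
  "listed p q = {
    (Unoccupied, False, False, Tight, [e0]),
    (Unoccupied, True, True, Tight, [e1]),
    (PreOneHalf, False, True, Tight, [pre p]),
    (PostOneHalf, True, False, Tight, [post p]),
    (Alternately, False, False, Singular, [pre q, post p]),
    (Alternately, True, True, Tight, [post p, pre q]),
    (Once, False, False, Tight, [pre p, post p]),
    (Once, True, True, Twisted, [post p, pre p]),
    (Once, True, True, Crossed, [cr p]),
    (PreSesqui, False, True, Tight, [pre p, post p, pre q]),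
    (PreSesqui, False, True, Sublime, [pre q, cr p]),
    (PreSesqui, False, True, Critical, [pre q, post p, pre p]),
    (PostSesqui, True, False, Tight, [post q, pre p, post p]),
    (PostSesqui, True, False, Sublime, [cr p, post q]),
    (PostSesqui, True, False, Critical, [post p, pre p, post q]),
    (Doubly, False, False, Tight, [pre p, post p, pre q, post q]),
    (Doubly, False, False, Sublime, [pre p, cr q, post p]),
    (Doubly, False, False, Critical, [pre p, post q, pre q, post p]),
    (Doubly, True, True, Tight, [post p, pre q, post q, pre p]),
    (Doubly, True, True, Sublime, [cr q, post p, pre p]),
    (Doubly, True, True, Sublime, [post p, pre p, cr q]),
    (Doubly, True, True, Crossed, [cr p, cr q]),
    (Doubly, True, True, Critical, [post p, pre p, post q, pre q])}"

end

theory Submission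
  imports Defs
begin

text \<open>
  A diagram is determined by its idempotents and by the moving strands on the two intervals, for each
  of which there are five possibilities; this leaves 22 diagrams. As long as no step is covered twice,
  the product of two diagrams is the diagram with the composed moving strands if there is one, and
  \<open>0\<close> otherwise. Only \<open>c\<^sub>p\<close>, \<open>c\<^sub>q\<close> and their product have crossings, with boundaries \<open>p\<^sub>+ p\<^sub>-\<close>, \<open>q\<^sub>+ q\<^sub>-\<close> and
  a sum of two tight diagrams. Hence the tight diagrams are those other than the three crossed ones and
  \<open>p\<^sub>+ p\<^sub>-\<close>, \<open>q\<^sub>+ q\<^sub>-\<close>. A viable tensor product without idempotents has at most four factors, and
  writing every factor as a product of the \<open>x\<^sub>-\<close>, \<open>x\<^sub>+\<close> and \<open>c\<^sub>x\<close> exhibits it as a contraction of a listed one.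
\<close>

section \<open>Elements as supports\<close>

text \<open>The obstacle is that a diagram is a sum of strand diagrams: horizontal strands at end
  points are free, and a dotted pair stands for two choices. A product of two diagrams might
  therefore contain only part of the composite diagram: a term could be lost to a double crossing,
  could fail to split because no intermediate position of the horizontal strand fits, or could
  cancel against another modulo 2. All three are excluded below, the first two one interval at a
  time. Strands never leave their interval, so a strand diagram is a pair of relations on three
  levels. There are only 15 such relations, and statements about them are decided by evaluation. The
  two intervals interact only through the number of occupied places, which \<open>s\<close> and
  \<open>t\<close> prescribe. The bound of four factors has a simple source: every factor other than
  an idempotent covers a step, and there are four steps, each covered at most once. This makes the
  classification itself a finite evaluation as well.\<close>

definition ind :: "strand_diagram set \<Rightarrow> element" where
  "ind A = (\<lambda>d. if d \<in> A then 1 else 0)"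

text \<open>Records which composites occur, not how often; that nothing is lost modulo 2 is the
  content of \<open>mult_ind\<close>.\<close>

definition compose_sets :: "strand_diagram set \<Rightarrow> strand_diagram set \<Rightarrow> strand_diagram set" where
  "compose_sets A B = {d O e | d e. d \<in> A \<and> e \<in> B \<and> Range d = Domain e \<and>
     inv_count (d O e) = inv_count d + inv_count e}"

lemma compose_setsI:
  assumes "d \<in> A" "e \<in> B" "Range d = Domain e" "inv_count (d O e) = inv_count d + inv_count e"
    "f = d O e"
  shows "f \<in> compose_sets A B"
  using assms unfolding compose_sets_def by blast

lemma sum_fun_apply: "(\<Sum>x\<in>A. f x) y = (\<Sum>x\<in>A. f x y)"
  by (induction A rule: infinite_finite_induct) auto

lemma finite_set_of_strand_diagrams [simp]: "finite (A :: strand_diagram set)"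
proof -
  have "finite (UNIV :: strand_diagram set)"
    by (simp add: Finite_Set.finite_set finite_Prod_UNIV)
  then show ?thesis by (rule finite_subset[rotated]) simp
qed

lemma sum_single: "(\<Sum>d\<in>A. single d) = ind A"
  by (rule ext) (simp add: sum_fun_apply single_def ind_def)

text \<open>Over \<open>bit\<close> the sum is the parity of the number of solutions, which detects
  existence as soon as there is at most one solution.\<close>

lemma sum_bit_unique:
  assumes "finite A" "\<And>x y. x \<in> A \<Longrightarrow> y \<in> A \<Longrightarrow> P x \<Longrightarrow> P y \<Longrightarrow> x = y"
  shows "(\<Sum>x\<in>A. if P x then 1 else 0 :: bit) = (if \<exists>x\<in>A. P x then 1 else 0)"
proof (cases "\<exists>x\<in>A. P x")
  case True
  then obtain x where x: "x \<in> A" "P x" by blast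
  then have "P y \<longleftrightarrow> y = x" if "y \<in> A" for y using assms(2) that by blast
  then have "(\<Sum>y\<in>A. if P y then 1 else 0 :: bit) = (\<Sum>y\<in>A. if y = x then 1 else 0)"
    by (intro sum.cong) auto
  then show ?thesis using assms(1) x by auto
next
  case False
  then show ?thesis by (auto intro: sum.neutral)
qed

lemma mult_apply:
  "(a \<odot> b) f = (\<Sum>d\<in>strand_diagrams. \<Sum>e\<in>strand_diagrams. a d * b e * sd_mult d e f)"
  by (simp add: mult_def sum_fun_apply scale_def)

lemma odot_zero_right: "a \<odot> 0 = 0"
  by (rule ext) (simp add: mult_apply)

text \<open>Isolates the property that rules out cancellation: the members differ only in their
  horizontal strands. Idempotents, \<open>a_elt\<close> and diagrams all have it, so
  \<open>mult_ind\<close> serves both multiplications inside \<open>diag\<close> as well as products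
  of diagrams.\<close>

definition same_moving :: "strand_diagram set \<Rightarrow> bool" where
  "same_moving A \<longleftrightarrow> A \<subseteq> strand_diagrams \<and> (\<forall>d\<in>A. \<forall>e\<in>A. d - Id = e - Id)"

lemma same_moving_mono: "same_moving A \<Longrightarrow> B \<subseteq> A \<Longrightarrow> same_moving B"
  unfolding same_moving_def by blast

text \<open>A point of the source that starts no moving strand carries a horizontal one, so the
  source fixes the horizontal strands too.\<close>

lemma same_moving_eqI:
  assumes "same_moving A" "d \<in> A" "e \<in> A" "Domain d = Domain e"
  shows "d = e"
proof -
  have sub: "d \<subseteq> e" if mem: "d \<in> A" "e \<in> A" and dom: "Domain d = Domain e" for d e
  proof
    fix z assume z: "z \<in> d"
    obtain x y where xy: "z = (x, y)" by force
    have moving: "d - Id = e - Id" and sv: "single_valued d"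
      using assms(1) mem unfolding same_moving_def strand_diagrams_def by blast+
    show "z \<in> e"
    proof (cases "x = y")
      case True
      obtain w where w: "(x, w) \<in> e" using z xy dom by blast
      have "w = x"
      proof (rule ccontr)
        assume "w \<noteq> x"
        then have "(x, w) \<in> d" using w moving by blast
        moreover have "(x, x) \<in> d" using z xy True by simp
        ultimately show False using sv \<open>w \<noteq> x\<close> by (blast dest: single_valuedD)
      qed
      then show ?thesis using w xy True by simp
    next
      case False
      then show ?thesis using z xy moving by blast
    qed
  qed
  show ?thesis
    by (rule equalityI; rule sub) (simp_all add: assms(2,3), simp_all only: assms(4))
qed

text \<open>
  A factor is determined by its source, and its target is the source of the next factor; hence no
  two pairs of terms have the same product and nothing cancels modulo 2.
\<close>

lemma mult_ind:
  assumes A: "same_moving A" and B: "same_moving B"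
  shows "ind A \<odot> ind B = ind (compose_sets A B)"
proof (rule ext)
  fix f
  let ?ok = "\<lambda>z. Range (fst z) = Domain (snd z) \<and>
    inv_count (fst z O snd z) = inv_count (fst z) + inv_count (snd z) \<and> fst z O snd z = f"
  have sub: "A \<subseteq> strand_diagrams" "B \<subseteq> strand_diagrams"
    using A B by (auto simp: same_moving_def)
  have ex: "(\<exists>z\<in>strand_diagrams \<times> strand_diagrams. fst z \<in> A \<and> snd z \<in> B \<and> ?ok z) \<longleftrightarrow>
      f \<in> compose_sets A B"
  proof
    assume "f \<in> compose_sets A B"
    then obtain d e where "d \<in> A" "e \<in> B" "?ok (d, e)" by (auto simp: compose_sets_def)
    then show "\<exists>z\<in>strand_diagrams \<times> strand_diagrams. fst z \<in> A \<and> snd z \<in> B \<and> ?ok z"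
      using sub by (intro bexI[of _ "(d, e)"]) auto
  next
    assume "\<exists>z\<in>strand_diagrams \<times> strand_diagrams. fst z \<in> A \<and> snd z \<in> B \<and> ?ok z"
    then obtain z where z: "fst z \<in> A" "snd z \<in> B" "?ok z" by blast
    show "f \<in> compose_sets A B"
      by (rule compose_setsI[OF z(1,2)]) (use z(3) in blast)+
  qed
  have "(ind A \<odot> ind B) f =
      (\<Sum>d\<in>strand_diagrams. \<Sum>e\<in>strand_diagrams.
        if d \<in> A \<and> e \<in> B \<and> ?ok (d, e) then 1 else 0)"
    unfolding mult_apply
    by (intro sum.cong) (auto simp: ind_def sd_mult_def single_def)
  also have "\<dots> = (\<Sum>z\<in>strand_diagrams \<times> strand_diagrams.
        if fst z \<in> A \<and> snd z \<in> B \<and> ?ok z then 1 else 0)"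
    by (simp add: sum.cartesian_product case_prod_beta)
  also have "\<dots> = (if \<exists>z\<in>strand_diagrams \<times> strand_diagrams.
        fst z \<in> A \<and> snd z \<in> B \<and> ?ok z then 1 else 0)"
  proof (rule sum_bit_unique)
    fix z w
    assume z: "fst z \<in> A \<and> snd z \<in> B \<and> ?ok z" and w: "fst w \<in> A \<and> snd w \<in> B \<and> ?ok w"
    have dom: "Domain (d O e) = Domain d" if "Range d = Domain e" for d e :: strand_diagram
      using that by blast
    have "Domain (fst z) = Domain f" "Domain (fst w) = Domain f"
      using z w dom[of "fst z" "snd z"] dom[of "fst w" "snd w"] by simp_all
    then have 1: "fst z = fst w" using z w by (intro same_moving_eqI[OF A]) simp_all
    have "Domain (snd z) = Domain (snd w)" using z w 1 by simp
    then have "snd z = snd w" using z w by (intro same_moving_eqI[OF B]) simp_all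
    then show "z = w" using 1 by (simp add: prod_eq_iff)
  qed simp
  also have "\<dots> = ind (compose_sets A B) f"
    by (simp only: ex ind_def)
  finally show "(ind A \<odot> ind B) f = ind (compose_sets A B) f" .
qed

section \<open>Diagrams as explicit sets of strand diagrams\<close>

lemma inv_count_identity: "d \<subseteq> Id \<Longrightarrow> inv_count d = 0"
proof -
  assume "d \<subseteq> Id"
  then have eq: "fst a = snd a" if "a \<in> d" for a using that by force
  have "crossings d = {}"
    using eq by (auto simp: crossings_def point_less_def dest!: eq)
  then show ?thesis by (simp add: inv_count_def)
qed

abbreviation places_in :: "point set \<Rightarrow> nat" where
  "places_in S \<equiv> card (S \<inter> range At)"

definition diag_terms :: "bool \<Rightarrow> strand_diagram \<Rightarrow> bool \<Rightarrow> strand_diagram set" where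
  "diag_terms s \<mu> t = {d \<in> strand_diagrams. d - Id = \<mu> \<and>
     places_in (Domain d) = (if s then 1 else 0) \<and> places_in (Range d) = (if t then 1 else 0)}"

lemma Id_on_in_strand_diagrams: "Id_on S \<in> strand_diagrams"
  by (auto simp: strand_diagrams_def single_valued_def point_le_def)

lemma idem_eq_ind: "idem s = ind {Id_on S | S. places_in S = (if s then 1 else 0)}"
proof -
  have inj: "inj_on Id_on X" for X :: "point set set"
    by (rule inj_on_inverseI[of _ Domain]) (rule Domain_Id_on)
  have "idem s = (\<Sum>d\<in>Id_on ` {S. places_in S = (if s then 1 else 0)}. single d)"
    by (simp only: idem_def sum.reindex[OF inj] o_def)
  then show ?thesis by (simp only: sum_single setcompr_eq_image)
qed

text \<open>Since \<open>\<mu>\<close> has no fixed points, \<open>U\<close> can be read off from a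
  summand as its set of fixed points. Hence no two summands coincide and none cancel.\<close>

lemma a_elt_eq_ind:
  assumes \<mu>: "\<mu> \<in> strand_diagrams" "irrefl \<mu>"
  shows "a_elt \<mu> = ind {d \<in> strand_diagrams. d - Id = \<mu>}"
proof -
  let ?U = "{U. U \<inter> (Domain \<mu> \<union> Range \<mu>) = {}}"
  have "inj_on (\<lambda>U. \<mu> \<union> Id_on U) ?U"
  proof (rule inj_onI)
    fix U V assume "U \<in> ?U" "V \<in> ?U" and eq: "\<mu> \<union> Id_on U = \<mu> \<union> Id_on V"
    have "x \<in> U \<longleftrightarrow> (x, x) \<in> \<mu> \<union> Id_on U" "x \<in> V \<longleftrightarrow> (x, x) \<in> \<mu> \<union> Id_on V" for x
      using \<mu>(2) by (auto simp: irrefl_def)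
    then show "U = V" using eq by blast
  qed
  then have "a_elt \<mu> = (\<Sum>d\<in>(\<lambda>U. \<mu> \<union> Id_on U) ` ?U. single d)"
    unfolding a_elt_def by (simp add: sum.reindex)
  moreover have "(\<lambda>U. \<mu> \<union> Id_on U) ` ?U = {d \<in> strand_diagrams. d - Id = \<mu>}"
  proof (intro equalityI subsetI)
    fix d assume "d \<in> (\<lambda>U. \<mu> \<union> Id_on U) ` ?U"
    then obtain U where U: "U \<inter> (Domain \<mu> \<union> Range \<mu>) = {}" "d = \<mu> \<union> Id_on U" by blast
    have "d - Id = \<mu>" using U \<mu>(2) by (auto simp: irrefl_def)
    moreover have "d \<in> strand_diagrams"
    proof -
      have \<mu>': "single_valued \<mu>" "single_valued (\<mu>\<inverse>)" "\<And>x y. (x, y) \<in> \<mu> \<Longrightarrow> x \<preceq> y"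
        using \<mu>(1) by (auto simp: strand_diagrams_def)
      have "single_valued d" unfolding U(2) single_valued_def
        using U(1) \<mu>'(1) by (auto dest: single_valuedD)
      moreover have "single_valued (d\<inverse>)" unfolding U(2) single_valued_def
        using U(1) \<mu>'(2) by (auto dest: single_valuedD)
      moreover have "x \<preceq> y" if "(x, y) \<in> d" for x y
        using that \<mu>'(3) by (auto simp: U(2) point_le_def)
      ultimately show ?thesis by (auto simp: strand_diagrams_def)
    qed
    ultimately show "d \<in> {d \<in> strand_diagrams. d - Id = \<mu>}" by simp
  next
    fix d assume d: "d \<in> {d \<in> strand_diagrams. d - Id = \<mu>}"
    \<comment> \<open>Because \<open>d\<close> and its converse are single-valued, no moving strand
      starts or ends at a point of \<open>?V\<close>, so \<open>?V\<close> is an admissible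
      \<open>U\<close>.\<close>
    let ?V = "{x. (x, x) \<in> d}"
    have sv: "single_valued d" "single_valued (d\<inverse>)" using d by (auto simp: strand_diagrams_def)
    have "d = \<mu> \<union> Id_on ?V" using d by auto
    moreover have "?V \<inter> (Domain \<mu> \<union> Range \<mu>) = {}"
      using d sv by (auto simp: single_valued_def)
    ultimately show "d \<in> (\<lambda>U. \<mu> \<union> Id_on U) ` ?U" by blast
  qed
  ultimately show ?thesis by (simp add: sum_single)
qed

lemma Id_on_O: "Id_on (Domain e) O e = e" "e O Id_on (Range e) = e"
  by auto

text \<open>An identity diagram changes no strand and adds no crossing, so the idempotents act as
  filters: the left one on the places in the source, the right one on those in the target.\<close>

lemma diag_eq_ind:
  assumes \<mu>: "\<mu> \<in> strand_diagrams" "irrefl \<mu>"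
  shows "diag s \<mu> t = ind (diag_terms s \<mu> t)"
proof -
  let ?I = "\<lambda>s. {Id_on S | S. places_in S = (if s then 1 else 0)}"
  let ?A = "{d \<in> strand_diagrams. d - Id = \<mu>}"
  let ?B = "{d \<in> ?A. places_in (Domain d) = (if s then 1 else 0)}"
  have I: "same_moving (?I s)" for s
    using Id_on_in_strand_diagrams by (auto simp: same_moving_def)
  have A: "same_moving ?A" by (auto simp: same_moving_def)
  have B: "same_moving ?B" using A by (rule same_moving_mono) auto
  have 1: "compose_sets (?I s) ?A = ?B"
  proof (intro equalityI subsetI)
    fix f assume "f \<in> compose_sets (?I s) ?A"
    then obtain S e where "f = Id_on S O e" "e \<in> ?A" "S = Domain e"
      "places_in S = (if s then 1 else 0)"
      by (auto simp: compose_sets_def)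
    then show "f \<in> ?B" using Id_on_O(1)[of e] by simp
  next
    fix f assume f: "f \<in> ?B"
    show "f \<in> compose_sets (?I s) ?A"
    proof (rule compose_setsI)
      show "Id_on (Domain f) \<in> ?I s" using f by blast
      show "f \<in> ?A" using f by blast
      show "Range (Id_on (Domain f)) = Domain f" by simp
      have "Id_on (Domain f) \<subseteq> Id" by auto
      then show "inv_count (Id_on (Domain f) O f) = inv_count (Id_on (Domain f)) + inv_count f"
        by (simp add: Id_on_O inv_count_identity)
      show "f = Id_on (Domain f) O f" by (simp only: Id_on_O)
    qed
  qed
  have 2: "compose_sets ?B (?I t) = diag_terms s \<mu> t"
  proof (intro equalityI subsetI)
    fix f assume "f \<in> compose_sets ?B (?I t)"
    then obtain S e where "f = e O Id_on S" "e \<in> ?B" "S = Range e"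
      "places_in S = (if t then 1 else 0)"
      by (auto simp: compose_sets_def)
    then show "f \<in> diag_terms s \<mu> t" using Id_on_O(2)[of e] by (simp add: diag_terms_def)
  next
    fix f assume f: "f \<in> diag_terms s \<mu> t"
    show "f \<in> compose_sets ?B (?I t)"
    proof (rule compose_setsI)
      show "f \<in> ?B" using f unfolding diag_terms_def by blast
      show "Id_on (Range f) \<in> ?I t" using f unfolding diag_terms_def by blast
      show "Range f = Domain (Id_on (Range f))" by simp
      have "Id_on (Range f) \<subseteq> Id" by auto
      then show "inv_count (f O Id_on (Range f)) = inv_count f + inv_count (Id_on (Range f))"
        by (simp add: Id_on_O inv_count_identity)
      show "f = f O Id_on (Range f)" by (simp only: Id_on_O)
    qed
  qed
  have "diag s \<mu> t = ind (?I s) \<odot> ind ?A \<odot> ind (?I t)"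
    by (simp only: diag_def idem_eq_ind a_elt_eq_ind[OF \<mu>])
  also have "\<dots> = ind ?B \<odot> ind (?I t)"
    by (simp only: mult_ind[OF I[of s] A] 1)
  also have "\<dots> = ind (diag_terms s \<mu> t)"
    by (simp only: mult_ind[OF B I[of t]] 2)
  finally show ?thesis .
qed

section \<open>Strand diagrams on one interval\<close>

datatype level = Bot | Mid | Top

fun level_of :: "point \<Rightarrow> level" where
  "level_of (NegInf x) = Bot"
| "level_of (At x) = Mid"
| "level_of (PosInf x) = Top"

fun pt :: "place \<Rightarrow> level \<Rightarrow> point" where
  "pt x Bot = NegInf x"
| "pt x Mid = At x"
| "pt x Top = PosInf x"

type_synonym interval_diagram = "(level \<times> level) set"

lemma interval_pt [simp]: "interval (pt x i) = x"
  by (cases i) auto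

lemma level_of_pt [simp]: "level_of (pt x i) = i"
  by (cases i) auto

lemma pt_interval_level_of [simp]: "pt (interval u) (level_of u) = u"
  by (cases u) auto

lemma pt_eq_iff [simp]: "pt x i = pt y j \<longleftrightarrow> x = y \<and> i = j"
  by (metis interval_pt level_of_pt)

definition on_interval :: "strand_diagram \<Rightarrow> place \<Rightarrow> interval_diagram" where
  "on_interval d x = {(i, j). (pt x i, pt x j) \<in> d}"

definition glue :: "(place \<Rightarrow> interval_diagram) \<Rightarrow> strand_diagram" where
  "glue f = {(u, v). interval u = interval v \<and> (level_of u, level_of v) \<in> f (interval u)}"

lemma on_interval_glue [simp]: "on_interval (glue f) = f"
  by (rule ext) (auto simp: on_interval_def glue_def)

definition steps_up :: "(level \<times> level) list" where
  "steps_up = [(Bot, Bot), (Bot, Mid), (Bot, Top), (Mid, Mid), (Mid, Top), (Top, Top)]"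

text \<open>An explicit list, so that a statement about all relations on one interval can be
  evaluated; \<open>set_interval_list\<close> ties it to the abstract description.\<close>

definition interval_list :: "interval_diagram list" where
  "interval_list =
     map set (filter (\<lambda>zs. distinct (map fst zs) \<and> distinct (map snd zs)) (subseqs steps_up))"

definition interval_diagrams :: "interval_diagram set" where
  "interval_diagrams = {r. r \<subseteq> set steps_up \<and> single_valued r \<and> single_valued (r\<inverse>)}"

lemma single_valued_iff_inj_on_fst: "single_valued r \<longleftrightarrow> inj_on fst r"
  by (fastforce simp: single_valued_def inj_on_def)

lemma single_valued_converse_iff_inj_on_snd: "single_valued (r\<inverse>) \<longleftrightarrow> inj_on snd r"
  by (fastforce simp: single_valued_def inj_on_def)

lemma interval_diagrams_iff:
  "r \<in> interval_diagrams \<longleftrightarrow> r \<subseteq> set steps_up \<and> inj_on fst r \<and> inj_on snd r"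
  unfolding interval_diagrams_def single_valued_converse_iff_inj_on_snd mem_Collect_eq
  unfolding single_valued_iff_inj_on_fst ..

lemma set_interval_list: "set interval_list = interval_diagrams"
proof -
  have sets: "set ` set (subseqs steps_up) = Pow (set steps_up)" by (rule subseqs_powset)
  have dist: "distinct zs" if "zs \<in> set (subseqs steps_up)" for zs
    using that by (rule subseqs_distinctD) (simp add: steps_up_def)
  show ?thesis
  proof (intro equalityI subsetI)
    fix r assume "r \<in> set interval_list"
    then obtain zs where zs: "zs \<in> set (subseqs steps_up)" "distinct (map fst zs)"
      "distinct (map snd zs)" "r = set zs"
      by (auto simp: interval_list_def)
    then have "r \<subseteq> set steps_up" using sets by blast
    with zs show "r \<in> interval_diagrams"
      by (simp add: interval_diagrams_iff distinct_map)
  next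
    fix r assume r: "r \<in> interval_diagrams"
    then have "r \<in> set ` set (subseqs steps_up)" using sets by (simp add: interval_diagrams_def)
    then obtain zs where zs: "zs \<in> set (subseqs steps_up)" "r = set zs" by blast
    then have "distinct (map fst zs) \<and> distinct (map snd zs)"
      using r dist[OF zs(1)]
      by (simp add: interval_diagrams_iff distinct_map)
    then show "r \<in> set interval_list" using zs by (simp add: interval_list_def)
  qed
qed

lemma strand_diagramsD:
  assumes "d \<in> strand_diagrams" "(u, v) \<in> d"
  shows "interval u = interval v" "(level_of u, level_of v) \<in> set steps_up"
proof -
  have le: "u \<preceq> v" using assms by (auto simp: strand_diagrams_def)
  then show "interval u = interval v" by (simp add: point_le_def)
  show "(level_of u, level_of v) \<in> set steps_up"
    using le by (cases u; cases v) (auto simp: point_le_def steps_up_def)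
qed

lemma glue_on_interval:
  assumes "d \<in> strand_diagrams"
  shows "glue (on_interval d) = d"
proof -
  have "(u, v) \<in> glue (on_interval d) \<longleftrightarrow> (u, v) \<in> d" for u v
    using strand_diagramsD(1)[OF assms, of u v] pt_interval_level_of[of v]
    by (auto simp: glue_def on_interval_def)
  then show ?thesis by auto
qed

lemma on_interval_in_interval_diagrams:
  assumes "d \<in> strand_diagrams"
  shows "on_interval d x \<in> interval_diagrams"
proof -
  have sv: "single_valued d" "single_valued (d\<inverse>)" using assms by (auto simp: strand_diagrams_def)
  have "on_interval d x \<subseteq> set steps_up"
    using strand_diagramsD(2)[OF assms] by (fastforce simp: on_interval_def)
  moreover have "single_valued (on_interval d x)"
    using sv(1) pt_eq_iff unfolding single_valued_def on_interval_def by blast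
  moreover have "single_valued ((on_interval d x)\<inverse>)"
    using sv(2) pt_eq_iff unfolding single_valued_def on_interval_def by blast
  ultimately show ?thesis by (simp add: interval_diagrams_def)
qed

lemma glue_in_strand_diagrams:
  assumes "\<And>x. f x \<in> interval_diagrams"
  shows "glue f \<in> strand_diagrams"
proof -
  have sv: "single_valued (f x)" "single_valued ((f x)\<inverse>)" "f x \<subseteq> set steps_up" for x
    using assms[of x] by (auto simp: interval_diagrams_def)
  have point_eqI: "u = v" if "interval u = interval v" "level_of u = level_of v" for u v
    using that pt_interval_level_of by metis
  have "single_valued (glue f)"
    by (rule single_valuedI, rule point_eqI) (auto simp: glue_def dest: single_valuedD[OF sv(1)])
  moreover have "single_valued ((glue f)\<inverse>)"
    by (rule single_valuedI, rule point_eqI)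
      (use sv(2) in \<open>auto simp: glue_def single_valued_def\<close>)
  moreover have "u \<preceq> v" if "(u, v) \<in> glue f" for u v
  proof -
    have "interval u = interval v" "(level_of u, level_of v) \<in> set steps_up"
      using that sv(3) by (auto simp: glue_def)
    then show ?thesis by (cases u; cases v) (auto simp: point_le_def steps_up_def)
  qed
  ultimately show ?thesis by (auto simp: strand_diagrams_def)
qed

lemma strand_diagrams_source_eq:
  assumes "d \<in> strand_diagrams" "(u, pt x j) \<in> d"
  shows "u = pt x (level_of u)"
  using strand_diagramsD(1)[OF assms] pt_interval_level_of[of u] by simp

lemma strand_diagrams_target_eq:
  assumes "d \<in> strand_diagrams" "(pt x i, v) \<in> d"
  shows "v = pt x (level_of v)"
  using strand_diagramsD(1)[OF assms] pt_interval_level_of[of v] by simp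

lemma Range_on_interval:
  assumes "d \<in> strand_diagrams"
  shows "j \<in> Range (on_interval d x) \<longleftrightarrow> pt x j \<in> Range d"
proof
  assume "pt x j \<in> Range d"
  then obtain u where u: "(u, pt x j) \<in> d" by blast
  then have "(pt x (level_of u), pt x j) \<in> d"
    using strand_diagrams_source_eq[OF assms u] by simp
  then show "j \<in> Range (on_interval d x)" by (auto simp: on_interval_def)
qed (auto simp: on_interval_def)

lemma Domain_on_interval:
  assumes "d \<in> strand_diagrams"
  shows "i \<in> Domain (on_interval d x) \<longleftrightarrow> pt x i \<in> Domain d"
proof
  assume "pt x i \<in> Domain d"
  then obtain v where v: "(pt x i, v) \<in> d" by blast
  then have "(pt x i, pt x (level_of v)) \<in> d"
    using strand_diagrams_target_eq[OF assms v] by simp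
  then show "i \<in> Domain (on_interval d x)" by (auto simp: on_interval_def)
qed (auto simp: on_interval_def)

lemma strand_diagrams_eqI:
  assumes "d \<in> strand_diagrams" "e \<in> strand_diagrams" "\<And>x. on_interval d x = on_interval e x"
  shows "d = e"
  using assms glue_on_interval by (metis ext)

lemma on_interval_relcomp:
  assumes "d \<in> strand_diagrams"
  shows "on_interval (d O e) x = on_interval d x O on_interval e x"
proof -
  have "(i, k) \<in> on_interval (d O e) x \<longleftrightarrow> (i, k) \<in> on_interval d x O on_interval e x" for i k
  proof
    assume "(i, k) \<in> on_interval (d O e) x"
    then obtain v where v: "(pt x i, v) \<in> d" "(v, pt x k) \<in> e" by (auto simp: on_interval_def)
    from v(1) have "v = pt x (level_of v)" by (rule strand_diagrams_target_eq[OF assms])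
    with v show "(i, k) \<in> on_interval d x O on_interval e x"
      by (metis (mono_tags, lifting) case_prodI mem_Collect_eq on_interval_def relcomp.relcompI)
  qed (auto simp: on_interval_def)
  then show ?thesis by auto
qed

lemma Range_eq_Domain_iff:
  assumes "d \<in> strand_diagrams" "e \<in> strand_diagrams"
  shows "Range d = Domain e \<longleftrightarrow> (\<forall>x. Range (on_interval d x) = Domain (on_interval e x))"
proof -
  note 1 = Range_on_interval[OF assms(1)] and 2 = Domain_on_interval[OF assms(2)]
  show ?thesis
  proof
    assume "Range d = Domain e"
    then have "j \<in> Range (on_interval d x) \<longleftrightarrow> j \<in> Domain (on_interval e x)" for x j
      by (simp only: 1 2)
    then show "\<forall>x. Range (on_interval d x) = Domain (on_interval e x)" by blast
  next
    assume *: "\<forall>x. Range (on_interval d x) = Domain (on_interval e x)"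
    have "u \<in> Range d \<longleftrightarrow> u \<in> Domain e" for u
      using * 1[of "level_of u" "interval u"] 2[of "level_of u" "interval u"] by simp
    then show "Range d = Domain e" by blast
  qed
qed

lemma UNIV_place: "UNIV = {PlaceP, PlaceQ}"
  using place.exhaust by auto

lemma all_place_iff: "(\<forall>x. P x) \<longleftrightarrow> P PlaceP \<and> P PlaceQ"
  by (metis (full_types) place.exhaust)

section \<open>Crossings and occupied places, interval by interval\<close>

definition crossing_number :: "interval_diagram \<Rightarrow> nat" where
  "crossing_number r = (if (Bot, Top) \<in> r \<and> (Mid, Mid) \<in> r then 1 else 0)"

text \<open>A crossing gives a chain \<open>u \<prec> u' \<preceq> v' \<prec> v\<close>. On three
  levels this forces the first strand to run through the whole interval and the second to be
  horizontal at the place, so each interval has at most one crossing.\<close>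

lemma crossings_eq:
  assumes "d \<in> strand_diagrams"
  shows "crossings d = (\<lambda>x. ((NegInf x, PosInf x), (At x, At x))) `
    {x. crossing_number (on_interval d x) = 1}"
proof -
  have eq: "z \<in> crossings d \<longleftrightarrow> (\<exists>x. z = ((NegInf x, PosInf x), (At x, At x)) \<and>
    (NegInf x, PosInf x) \<in> d \<and> (At x, At x) \<in> d)" for z
  proof
    assume z: "z \<in> crossings d"
    obtain u v u' v' where uv: "z = ((u, v), (u', v'))" by (metis surj_pair)
    then have d: "(u, v) \<in> d" "(u', v') \<in> d" "u \<prec> u'" "v' \<prec> v"
      using z by (auto simp: crossings_def)
    have "u \<preceq> v" "u' \<preceq> v'" using d assms by (auto simp: strand_diagrams_def)
    with d show "\<exists>x. z = ((NegInf x, PosInf x), (At x, At x)) \<and>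
        (NegInf x, PosInf x) \<in> d \<and> (At x, At x) \<in> d"
      unfolding uv by (cases u; cases v; cases u'; cases v')
        (auto simp: point_less_def point_le_def)
  qed (auto simp: crossings_def point_less_def)
  have "crossing_number (on_interval d x) = 1 \<longleftrightarrow> (NegInf x, PosInf x) \<in> d \<and> (At x, At x) \<in> d" for x
    by (simp add: crossing_number_def on_interval_def)
  then show ?thesis by (intro set_eqI) (simp only: eq image_iff mem_Collect_eq, blast)
qed

lemma inv_count_eq:
  assumes "d \<in> strand_diagrams"
  shows "inv_count d = crossing_number (on_interval d PlaceP) + crossing_number (on_interval d PlaceQ)"
proof -
  have "inv_count d = card {x. crossing_number (on_interval d x) = 1}"
    unfolding inv_count_def crossings_eq[OF assms] by (rule card_image) (auto simp: inj_on_def)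
  also have "{x. crossing_number (on_interval d x) = 1} =
      (if crossing_number (on_interval d PlaceP) = 1 then {PlaceP} else {}) \<union>
      (if crossing_number (on_interval d PlaceQ) = 1 then {PlaceQ} else {})"
    (is "?A = ?B")
  proof -
    have "x \<in> ?A \<longleftrightarrow> x \<in> ?B" for x by (cases x) simp_all
    then show ?thesis by blast
  qed
  finally show ?thesis by (auto simp: crossing_number_def)
qed

text \<open>A number rather than a truth value, so that the condition imposed by an idempotent
  becomes a sum over the two intervals.\<close>

definition mid_source :: "interval_diagram \<Rightarrow> nat" where
  "mid_source r = (if Mid \<in> Domain r then 1 else 0)"

definition mid_target :: "interval_diagram \<Rightarrow> nat" where
  "mid_target r = (if Mid \<in> Range r then 1 else 0)"

lemma places_in_eq: "places_in S = (if At PlaceP \<in> S then 1 else 0) + (if At PlaceQ \<in> S then 1 else 0)"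
proof -
  have "S \<inter> range At = (if At PlaceP \<in> S then {At PlaceP} else {}) \<union>
      (if At PlaceQ \<in> S then {At PlaceQ} else {})"
    by (auto simp: UNIV_place)
  then show ?thesis by auto
qed

lemma places_in_Domain:
  assumes "d \<in> strand_diagrams"
  shows "places_in (Domain d) = mid_source (on_interval d PlaceP) + mid_source (on_interval d PlaceQ)"
proof -
  have "At x \<in> Domain d \<longleftrightarrow> Mid \<in> Domain (on_interval d x)" for x
    by (simp only: Domain_on_interval[OF assms] pt.simps)
  then show ?thesis by (simp add: places_in_eq mid_source_def)
qed

lemma places_in_Range:
  assumes "d \<in> strand_diagrams"
  shows "places_in (Range d) = mid_target (on_interval d PlaceP) + mid_target (on_interval d PlaceQ)"
proof -
  have "At x \<in> Range d \<longleftrightarrow> Mid \<in> Range (on_interval d x)" for x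
    by (simp only: Range_on_interval[OF assms] pt.simps)
  then show ?thesis by (simp add: places_in_eq mid_target_def)
qed

section \<open>Moving strands on one interval and their composition\<close>

datatype motion = Still | Pre | Post | Long | Broken

fun moving :: "motion \<Rightarrow> interval_diagram" where
  "moving Still = {}"
| "moving Pre = {(Bot, Mid)}"
| "moving Post = {(Mid, Top)}"
| "moving Long = {(Bot, Top)}"
| "moving Broken = {(Bot, Mid), (Mid, Top)}"

definition motion_of :: "interval_diagram \<Rightarrow> motion" where
  "motion_of r =
     (if (Bot, Top) \<in> r then Long
      else if (Bot, Mid) \<in> r then if (Mid, Top) \<in> r then Broken else Pre
      else if (Mid, Top) \<in> r then Post else Still)"

fun before :: "motion \<Rightarrow> bool" where
  "before m \<longleftrightarrow> m = Pre \<or> m = Long \<or> m = Broken"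

fun after :: "motion \<Rightarrow> bool" where
  "after m \<longleftrightarrow> m = Post \<or> m = Long \<or> m = Broken"

definition disjoint_motions :: "motion \<Rightarrow> motion \<Rightarrow> bool" where
  "disjoint_motions m n \<longleftrightarrow> \<not> (before m \<and> before n) \<and> \<not> (after m \<and> after n)"

text \<open>Among motions with no common step, the last clause is reached only for
  \<open>n = Still\<close>; on motions that share a step its value has no meaning.\<close>

fun join :: "motion \<Rightarrow> motion \<Rightarrow> motion" where
  "join Still n = n"
| "join Pre Post = Long"
| "join Post Pre = Broken"
| "join m _ = m"

text \<open>Kept separate from \<open>departures\<close> to state conservation without subtraction:
  occupation of the place at the end plus departures equals occupation at the start plus
  arrivals.\<close>

fun arrivals :: "motion \<Rightarrow> nat" where
  "arrivals m = (if m = Pre \<or> m = Broken then 1 else 0)"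

fun departures :: "motion \<Rightarrow> nat" where
  "departures m = (if m = Post \<or> m = Broken then 1 else 0)"

text \<open>The possible values of \<open>mid_source\<close>. Only \<open>Still\<close> and
  \<open>Long\<close> leave a choice, namely whether there is a horizontal strand at the
  place.\<close>

fun mid_sources :: "motion \<Rightarrow> nat list" where
  "mid_sources Still = [0, 1]"
| "mid_sources Pre = [0]"
| "mid_sources Post = [1]"
| "mid_sources Long = [0, 1]"
| "mid_sources Broken = [1]"

definition motions :: "motion list" where
  "motions = [Still, Pre, Post, Long, Broken]"

lemma mem_motions [simp]: "m \<in> set motions"
  unfolding motions_def by (cases m) simp_all

text \<open>Here \<open>k\<close> is the occupation of the place between the two factors, obtained
  from \<open>i\<close> by conservation across \<open>m\<close>; it has to be admissible for
  \<open>n\<close>.\<close>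

definition factors_at :: "motion \<Rightarrow> motion \<Rightarrow> nat \<Rightarrow> bool" where
  "factors_at m n i \<longleftrightarrow> i \<in> set (mid_sources m) \<and>
     (\<exists>k\<in>set (mid_sources n). i + arrivals m = k + departures m)"

text \<open>\<open>Set.filter\<close> replaces the difference with \<open>Id\<close> to keep the
  statement executable; \<open>interval_motion\<close> restores the usual form.\<close>

lemma interval_motion_code:
  "\<forall>r\<in>set interval_list. Set.filter (\<lambda>z. fst z \<noteq> snd z) r = moving (motion_of r) \<and>
     mid_target r + departures (motion_of r) = mid_source r + arrivals (motion_of r) \<and>
     mid_source r \<in> set (mid_sources (motion_of r))"
  by code_simp

lemma interval_sources_code:
  "\<forall>m\<in>set motions. \<forall>i\<in>set (mid_sources m). \<exists>r\<in>set interval_list. motion_of r = m \<and> mid_source r = i"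
  by code_simp

text \<open>The crossing numbers add up for this reason: a long strand composed of two halves passes
  through the place in the middle, which leaves no room for a horizontal strand there. So a crossing
  of the composite already lies in one factor, while the other factor is horizontal on this
  interval.\<close>

lemma interval_compose_code:
  "\<forall>r\<in>set interval_list. \<forall>r'\<in>set interval_list.
     disjoint_motions (motion_of r) (motion_of r') \<longrightarrow> Range r = Domain r' \<longrightarrow>
     r O r' \<in> set interval_list \<and> motion_of (r O r') = join (motion_of r) (motion_of r') \<and>
     crossing_number (r O r') = crossing_number r + crossing_number r'"
  by code_simp

text \<open>Converse to \<open>interval_compose_code\<close>: the only possible obstruction to
  splitting a relation is the occupation of the place in the middle, and \<open>factors_at\<close>
  excludes it.\<close>

lemma interval_factor_code:
  "\<forall>m\<in>set motions. \<forall>n\<in>set motions. disjoint_motions m n \<longrightarrow>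
     (\<forall>r\<in>set interval_list. motion_of r = join m n \<longrightarrow> factors_at m n (mid_source r) \<longrightarrow>
       (\<exists>r\<^sub>1\<in>set interval_list. motion_of r\<^sub>1 = m \<and>
         (\<exists>r\<^sub>2\<in>set interval_list. motion_of r\<^sub>2 = n \<and> Range r\<^sub>1 = Domain r\<^sub>2 \<and> r = r\<^sub>1 O r\<^sub>2)))"
  by code_simp

lemma moving_code:
  "\<forall>m\<in>set motions. moving m \<in> set interval_list \<and> motion_of (moving m) = m \<and>
     card (Set.filter (\<lambda>z. fst z = Bot \<and> snd z \<noteq> Bot) (moving m)) = (if before m then 1 else 0) \<and>
     card (Set.filter (\<lambda>z. fst z \<noteq> Top \<and> snd z = Top) (moving m)) = (if after m then 1 else 0)"
  by code_simp

section \<open>Codes of diagrams\<close>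

text \<open>
  \<open>(s, a, b, t)\<close> is the diagram from \<open>s\<close> to \<open>t\<close> whose moving strands are those of \<open>a\<close> on the interval of
  \<open>PlaceP\<close> and of \<open>b\<close> on that of \<open>PlaceQ\<close>; its horizontal strands at the places are determined by
  \<open>s\<close> and \<open>t\<close>.
\<close>

type_synonym code = "bool \<times> motion \<times> motion \<times> bool"

fun num :: "bool \<Rightarrow> nat" where
  "num b = (if b then 1 else 0)"

fun select :: "motion \<Rightarrow> motion \<Rightarrow> place \<Rightarrow> motion" where
  "select a b PlaceP = a"
| "select a b PlaceQ = b"

definition moving_strands :: "motion \<Rightarrow> motion \<Rightarrow> strand_diagram" where
  "moving_strands a b = glue (\<lambda>x. moving (select a b x))"

fun terms :: "code \<Rightarrow> strand_diagram set" where
  "terms (s, a, b, t) = diag_terms s (moving_strands a b) t"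

fun dgm :: "code \<Rightarrow> element" where
  "dgm (s, a, b, t) = diag s (moving_strands a b) t"

fun valid :: "code \<Rightarrow> bool" where
  "valid (s, a, b, t) \<longleftrightarrow>
     num s + arrivals a + arrivals b = num t + departures a + departures b \<and>
     (\<exists>i\<in>set (mid_sources a). \<exists>j\<in>set (mid_sources b). i + j = num s)"

fun csrc :: "code \<Rightarrow> bool" where "csrc (s, a, b, t) = s"

fun ctgt :: "code \<Rightarrow> bool" where "ctgt (s, a, b, t) = t"

fun cover :: "code \<Rightarrow> step \<Rightarrow> nat" where
  "cover (s, a, b, t) (Before x) = num (before (select a b x))"
| "cover (s, a, b, t) (After x) = num (after (select a b x))"

declare num.simps [simp del] terms.simps [simp del] arrivals.simps [simp del] departures.simps [simp del]

lemma num_eq_iff [simp]: "num s = num t \<longleftrightarrow> s = t"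
  by (simp add: num.simps)

lemma interval_motion:
  assumes "r \<in> interval_diagrams"
  shows "r - Id = moving (motion_of r)"
    "mid_target r + departures (motion_of r) = mid_source r + arrivals (motion_of r)"
    "mid_source r \<in> set (mid_sources (motion_of r))"
proof -
  have "r - Id = Set.filter (\<lambda>z. fst z \<noteq> snd z) r" by auto
  then show "r - Id = moving (motion_of r)"
    "mid_target r + departures (motion_of r) = mid_source r + arrivals (motion_of r)"
    "mid_source r \<in> set (mid_sources (motion_of r))"
    using interval_motion_code assms unfolding set_interval_list by blast+
qed

lemma moving_in_interval_diagrams [simp]: "moving m \<in> interval_diagrams"
  using moving_code by (simp add: set_interval_list)

lemma motion_of_moving [simp]: "motion_of (moving m) = m"
  using moving_code by simp

lemma moving_strands_in_strand_diagrams: "moving_strands a b \<in> strand_diagrams"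
  unfolding moving_strands_def by (rule glue_in_strand_diagrams) simp

lemma minus_Id_eq_moving_strands_iff:
  assumes d: "d \<in> strand_diagrams"
  shows "d - Id = moving_strands a b \<longleftrightarrow>
    motion_of (on_interval d PlaceP) = a \<and> motion_of (on_interval d PlaceQ) = b"
proof -
  have "d - Id \<in> strand_diagrams"
    using d by (auto simp: strand_diagrams_def single_valued_def)
  moreover have "on_interval (d - Id) x = on_interval d x - Id" for x
    by (auto simp: on_interval_def)
  ultimately have "d - Id = moving_strands a b \<longleftrightarrow>
      (\<forall>x. on_interval d x - Id = moving (select a b x))"
    using moving_strands_in_strand_diagrams[of a b] strand_diagrams_eqI[of "d - Id" "moving_strands a b"]
    by (metis moving_strands_def on_interval_glue)
  also have "\<dots> \<longleftrightarrow> (\<forall>x. motion_of (on_interval d x) = select a b x)"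
    using interval_motion(1)[OF on_interval_in_interval_diagrams[OF d]] motion_of_moving by metis
  finally show ?thesis by (simp add: all_place_iff)
qed

lemma mem_terms_iff:
  "d \<in> terms (s, a, b, t) \<longleftrightarrow> d \<in> strand_diagrams \<and>
     motion_of (on_interval d PlaceP) = a \<and> motion_of (on_interval d PlaceQ) = b \<and>
     mid_source (on_interval d PlaceP) + mid_source (on_interval d PlaceQ) = num s \<and>
     mid_target (on_interval d PlaceP) + mid_target (on_interval d PlaceQ) = num t"
  by (cases "d \<in> strand_diagrams")
    (simp_all add: terms.simps num.simps diag_terms_def minus_Id_eq_moving_strands_iff places_in_Domain places_in_Range)

lemma irrefl_moving_strands: "irrefl (moving_strands a b)"
proof -
  have "(i, i) \<notin> moving m" for i m by (cases m; cases i) auto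
  then show ?thesis by (auto simp: irrefl_def moving_strands_def glue_def)
qed

lemma dgm_eq_ind: "dgm c = ind (terms c)"
  by (cases c) (simp add: terms.simps diag_eq_ind moving_strands_in_strand_diagrams irrefl_moving_strands)

lemma same_moving_terms: "same_moving (terms c)"
  by (cases c) (simp add: same_moving_def diag_terms_def terms.simps subset_iff)

lemma glue_select_mem_terms_iff:
  assumes "r \<in> interval_diagrams" "r' \<in> interval_diagrams"
  shows "glue (\<lambda>x. case x of PlaceP \<Rightarrow> r | PlaceQ \<Rightarrow> r') \<in> terms (s, a, b, t) \<longleftrightarrow>
    motion_of r = a \<and> motion_of r' = b \<and> mid_source r + mid_source r' = num s \<and>
    mid_target r + mid_target r' = num t"
proof -
  have "glue (\<lambda>x. case x of PlaceP \<Rightarrow> r | PlaceQ \<Rightarrow> r') \<in> strand_diagrams"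
    by (rule glue_in_strand_diagrams) (simp add: assms split: place.split)
  then show ?thesis by (simp add: mem_terms_iff)
qed

text \<open>Choosing \<open>i\<close> and \<open>j\<close> decides which places carry a horizontal
  strand; the target then has the right number of places by the balance equation in
  \<open>valid\<close>.\<close>

lemma terms_nonempty_iff: "terms c \<noteq> {} \<longleftrightarrow> valid c"
proof -
  obtain s a b t where c: "c = (s, a, b, t)" by (cases c)
  show ?thesis
  proof
    assume "terms c \<noteq> {}"
    then obtain d where d: "d \<in> terms (s, a, b, t)" using c by blast
    then have sd: "d \<in> strand_diagrams" by (simp add: mem_terms_iff)
    note m = interval_motion(2,3)[OF on_interval_in_interval_diagrams[OF sd]]
    show "valid c"
      using d m[of PlaceP] m[of PlaceQ]
      by (auto simp: c mem_terms_iff)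
  next
    assume v: "valid c"
    then obtain i j where ij: "i \<in> set (mid_sources a)" "j \<in> set (mid_sources b)" "i + j = num s"
      by (auto simp: c)
    obtain r where r: "r \<in> interval_diagrams" "motion_of r = a" "mid_source r = i"
      using interval_sources_code ij(1) mem_motions unfolding set_interval_list by blast
    obtain r' where r': "r' \<in> interval_diagrams" "motion_of r' = b" "mid_source r' = j"
      using interval_sources_code ij(2) mem_motions unfolding set_interval_list by blast
    have "mid_target r + mid_target r' = num t"
      using interval_motion(2)[OF r(1)] interval_motion(2)[OF r'(1)] r r' v ij(3)
      by (simp add: c)
    then have "glue (\<lambda>x. case x of PlaceP \<Rightarrow> r | PlaceQ \<Rightarrow> r') \<in> terms c"
      using r r' ij(3) by (simp add: c glue_select_mem_terms_iff)
    then show "terms c \<noteq> {}" by blast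
  qed
qed

lemma ind_eq_iff [simp]: "ind A = ind B \<longleftrightarrow> A = B"
proof -
  have "A = {d. ind A d = 1}" for A by (simp add: ind_def)
  then show ?thesis by metis
qed

lemma ind_empty [simp]: "ind {} = 0"
  by (rule ext) (simp add: ind_def)

lemma dgm_nonzero_iff: "dgm c \<noteq> 0 \<longleftrightarrow> valid c"
  by (metis dgm_eq_ind ind_empty ind_eq_iff terms_nonempty_iff)

text \<open>One common term is enough, since a term shows its motions and the numbers of places in
  its source and target. This makes the definite description in \<open>hdata_of\<close> well
  defined.\<close>

lemma dgm_inject:
  assumes "valid c" "dgm c = dgm c'"
  shows "c = c'"
proof -
  have "terms c = terms c'" using assms(2) by (simp add: dgm_eq_ind)
  moreover obtain d where "d \<in> terms c" using assms(1) terms_nonempty_iff by blast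
  moreover obtain s a b t s' a' b' t' where "c = (s, a, b, t)" "c' = (s', a', b', t')"
    by (metis surj_pair)
  ultimately have "d \<in> terms (s, a, b, t)" "d \<in> terms (s', a', b', t')" and
    c: "c = (s, a, b, t)" "c' = (s', a', b', t')" by simp_all
  then have "a = a'" "b = b'" "num s = num s'" "num t = num t'"
    unfolding mem_terms_iff by simp_all
  then show ?thesis using c by simp
qed

lemma irrefl_strand_diagram_moving_strands:
  assumes "\<mu> \<in> strand_diagrams" "irrefl \<mu>"
  obtains a b where "\<mu> = moving_strands a b"
proof -
  have "\<mu> - Id = \<mu>" using assms(2) by (auto simp: irrefl_def)
  then show ?thesis
    using that minus_Id_eq_moving_strands_iff[OF assms(1)] by metis
qed

lemma is_diagram_iff: "is_diagram D \<longleftrightarrow> (\<exists>c. valid c \<and> D = dgm c)"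
proof
  assume "is_diagram D"
  then obtain s \<mu> t where \<mu>: "\<mu> \<in> strand_diagrams" "irrefl \<mu>" "D = diag s \<mu> t" "D \<noteq> 0"
    by (auto simp: is_diagram_def)
  obtain a b where "\<mu> = moving_strands a b"
    using irrefl_strand_diagram_moving_strands[OF \<mu>(1,2)] .
  then have "D = dgm (s, a, b, t)" using \<mu> by simp
  then show "\<exists>c. valid c \<and> D = dgm c" using \<mu>(4) dgm_nonzero_iff by blast
next
  assume "\<exists>c. valid c \<and> D = dgm c"
  then obtain s a b t where "valid (s, a, b, t)" "D = dgm (s, a, b, t)" by (metis surj_pair)
  then show "is_diagram D"
    using dgm_nonzero_iff[of "(s, a, b, t)"] moving_strands_in_strand_diagrams irrefl_moving_strands
    unfolding is_diagram_def by (metis dgm.simps)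
qed

lemma covering_glue:
  "covering (glue f) (Before x) = card (Set.filter (\<lambda>z. fst z = Bot \<and> snd z \<noteq> Bot) (f x))"
  "covering (glue f) (After x) = card (Set.filter (\<lambda>z. fst z \<noteq> Top \<and> snd z = Top) (f x))"
proof -
  have inj: "inj_on (map_prod (pt x) (pt x)) A" for A by (auto simp: inj_on_def)
  have mem_image: "(u, v) \<in> map_prod (pt x) (pt x) ` F \<longleftrightarrow>
      interval u = x \<and> interval v = x \<and> (level_of u, level_of v) \<in> F" for u v F
  proof
    assume "interval u = x \<and> interval v = x \<and> (level_of u, level_of v) \<in> F"
    then show "(u, v) \<in> map_prod (pt x) (pt x) ` F"
      using pt_interval_level_of[of u] pt_interval_level_of[of v]
      by (intro image_eqI[of _ _ "(level_of u, level_of v)"]) simp_all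
  qed auto
  have 1: "{(u, v). (u, v) \<in> glue f \<and> u \<preceq> step_start (Before x) \<and> step_end (Before x) \<preceq> v} =
      map_prod (pt x) (pt x) ` Set.filter (\<lambda>z. fst z = Bot \<and> snd z \<noteq> Bot) (f x)" (is "?A = ?B")
  proof (rule set_eqI)
    fix z :: "point \<times> point"
    obtain u v where z: "z = (u, v)" by (cases z)
    show "z \<in> ?A \<longleftrightarrow> z \<in> ?B"
      unfolding z mem_image by (cases u; cases v) (auto simp: glue_def point_le_def)
  qed
  have 2: "{(u, v). (u, v) \<in> glue f \<and> u \<preceq> step_start (After x) \<and> step_end (After x) \<preceq> v} =
      map_prod (pt x) (pt x) ` Set.filter (\<lambda>z. fst z \<noteq> Top \<and> snd z = Top) (f x)" (is "?A = ?B")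
  proof (rule set_eqI)
    fix z :: "point \<times> point"
    obtain u v where z: "z = (u, v)" by (cases z)
    show "z \<in> ?A \<longleftrightarrow> z \<in> ?B"
      unfolding z mem_image by (cases u; cases v) (auto simp: glue_def point_le_def)
  qed
  show "covering (glue f) (Before x) = card (Set.filter (\<lambda>z. fst z = Bot \<and> snd z \<noteq> Bot) (f x))"
    "covering (glue f) (After x) = card (Set.filter (\<lambda>z. fst z \<noteq> Top \<and> snd z = Top) (f x))"
    by (simp_all only: covering_def 1 2 card_image[OF inj])
qed

lemma covering_moving_strands: "covering (moving_strands a b) = cover (s, a, b, t)"
proof
  fix z
  show "covering (moving_strands a b) z = cover (s, a, b, t) z"
    unfolding moving_strands_def using moving_code
    by (cases z) (simp_all only: covering_glue cover.simps num.simps mem_motions Ball_def)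
qed

lemma has_hdata_iff:
  "has_hdata D k \<longleftrightarrow> (\<exists>c. valid c \<and> D = dgm c \<and> k = (cover c, csrc c, ctgt c))"
proof
  assume "has_hdata D k"
  then obtain s \<mu> t where \<mu>: "\<mu> \<in> strand_diagrams" "irrefl \<mu>" "D = diag s \<mu> t" "D \<noteq> 0"
    "k = (covering \<mu>, s, t)"
    by (auto simp: has_hdata_def)
  obtain a b where ab: "\<mu> = moving_strands a b"
    using irrefl_strand_diagram_moving_strands[OF \<mu>(1,2)] .
  then have "D = dgm (s, a, b, t)" "valid (s, a, b, t)"
    using \<mu> dgm_nonzero_iff[of "(s, a, b, t)"] by simp_all
  then show "\<exists>c. valid c \<and> D = dgm c \<and> k = (cover c, csrc c, ctgt c)"
    using \<mu>(5) covering_moving_strands[of a b s t] by (intro exI[of _ "(s, a, b, t)"]) (simp add: ab)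
next
  assume "\<exists>c. valid c \<and> D = dgm c \<and> k = (cover c, csrc c, ctgt c)"
  then obtain c where "valid c" "D = dgm c" "k = (cover c, csrc c, ctgt c)" by blast
  moreover obtain s a b t where "c = (s, a, b, t)" by (cases c)
  ultimately show "has_hdata D k"
    unfolding has_hdata_def
    using dgm_nonzero_iff[of c] covering_moving_strands[of a b s t]
      moving_strands_in_strand_diagrams[of a b] irrefl_moving_strands[of a b]
    by (intro exI[of _ s] exI[of _ "moving_strands a b"] exI[of _ t]) auto
qed

lemma hdata_of_dgm:
  assumes "valid c"
  shows "hdata_of (dgm c) = (cover c, csrc c, ctgt c)"
  unfolding hdata_of_def has_hdata_iff
  by (rule the_equality) (use assms dgm_inject in blast)+

lemma hdata_dgm [simp]:
  assumes "valid c"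
  shows "h_of (dgm c) = cover c" "src (dgm c) = csrc c" "tgt (dgm c) = ctgt c"
  by (simp_all add: h_of_def src_def tgt_def hdata_of_dgm[OF assms])

section \<open>Products of two diagrams\<close>

fun ccomp :: "code \<Rightarrow> code \<Rightarrow> code" where
  "ccomp (s, a, b, t) (t', a', b', u) = (s, join a a', join b b', u)"

fun cdisjoint :: "code \<Rightarrow> code \<Rightarrow> bool" where
  "cdisjoint (s, a, b, t) (t', a', b', u) \<longleftrightarrow> disjoint_motions a a' \<and> disjoint_motions b b'"

definition codes :: "code list" where
  "codes =
    [(False, Still, Still, False), (False, Still, Pre, True), (False, Still, Long, False),
     (False, Pre, Still, True), (False, Pre, Long, True), (False, Long, Still, False),
     (False, Long, Pre, True), (False, Long, Long, False), (True, Still, Still, True),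
     (True, Still, Post, False), (True, Still, Long, True), (True, Still, Broken, True),
     (True, Pre, Post, True), (True, Post, Still, False), (True, Post, Pre, True),
     (True, Post, Long, False), (True, Long, Still, True), (True, Long, Post, False),
     (True, Long, Long, True), (True, Long, Broken, True), (True, Broken, Still, True),
     (True, Broken, Long, True)]"

lemma set_codes: "c \<in> set codes \<longleftrightarrow> valid c"
proof -
  obtain s a b t where "c = (s, a, b, t)" by (cases c)
  then show ?thesis
    by (cases s; cases t; cases a; cases b)
      (simp_all add: codes_def num.simps arrivals.simps departures.simps)
qed

text \<open>A term of the composite may have its horizontal strand at either place. Every such
  position has to be compatible with both factors on both intervals; this is where the intervals
  interact, through \<open>i + j = num s\<close>.\<close>

lemma factors_at_code:
  "\<forall>c\<in>set codes. \<forall>c'\<in>set codes. ctgt c = csrc c' \<longrightarrow> cdisjoint c c' \<longrightarrow>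
     (case (c, c') of ((s, a, b, t), (t', a', b', u)) \<Rightarrow>
       (\<forall>i\<in>set (mid_sources (join a a')). \<forall>j\<in>set (mid_sources (join b b')).
          i + j = num s \<longrightarrow> factors_at a a' i \<and> factors_at b b' j))"
  by code_simp

lemma interval_compose:
  assumes "r \<in> interval_diagrams" "r' \<in> interval_diagrams"
    "disjoint_motions (motion_of r) (motion_of r')" "Range r = Domain r'"
  shows "motion_of (r O r') = join (motion_of r) (motion_of r')"
    "crossing_number (r O r') = crossing_number r + crossing_number r'"
    "r O r' \<in> interval_diagrams"
  using bspec[OF bspec[OF interval_compose_code[unfolded set_interval_list] assms(1)] assms(2)]
    assms(3,4) by simp_all

lemma interval_factor:
  assumes "r \<in> interval_diagrams" "disjoint_motions m n" "motion_of r = join m n"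
    "factors_at m n (mid_source r)"
  obtains r\<^sub>1 r\<^sub>2 where "r\<^sub>1 \<in> interval_diagrams" "motion_of r\<^sub>1 = m"
    "r\<^sub>2 \<in> interval_diagrams" "motion_of r\<^sub>2 = n" "Range r\<^sub>1 = Domain r\<^sub>2" "r = r\<^sub>1 O r\<^sub>2"
proof -
  note * = mp[OF bspec[OF bspec[OF interval_factor_code[unfolded set_interval_list]
      mem_motions[of m]] mem_motions[of n]] assms(2)]
  show ?thesis
    using mp[OF mp[OF bspec[OF * assms(1)] assms(3)] assms(4)] that by blast
qed

lemma mid_source_relcomp: "Range r = Domain r' \<Longrightarrow> mid_source (r O r') = mid_source r"
  and mid_target_relcomp: "Range r = Domain r' \<Longrightarrow> mid_target (r O r') = mid_target r'"
  and mid_target_eq_mid_source: "Range r = Domain r' \<Longrightarrow> mid_target r = mid_source r'"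
proof -
  assume eq: "Range r = Domain r'"
  then have "Domain (r O r') = Domain r" "Range (r O r') = Range r'" by blast+
  with eq show "mid_source (r O r') = mid_source r" "mid_target (r O r') = mid_target r'"
    "mid_target r = mid_source r'"
    by (simp_all add: mid_source_def mid_target_def)
qed

lemma relcomp_in_strand_diagrams:
  assumes "d \<in> strand_diagrams" "e \<in> strand_diagrams"
  shows "d O e \<in> strand_diagrams"
proof -
  have "single_valued (d O e)" "single_valued ((d O e)\<inverse>)"
    using assms by (simp_all add: strand_diagrams_def single_valued_relcomp converse_relcomp)
  moreover have "x \<preceq> z" if "(x, z) \<in> d O e" for x z
    using that assms by (fastforce simp: strand_diagrams_def point_le_def)
  ultimately show ?thesis by (auto simp: strand_diagrams_def)
qed

text \<open>No term of the composite diagram is missing: each of its two interval parts splits by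
  \<open>interval_factor\<close>, and conservation puts the halves into the two factors. If
  \<open>ccomp c c'\<close> is not valid, both sides are empty, which is how products
  vanish.\<close>

lemma compose_terms:
  assumes "valid c" "valid c'" "ctgt c = csrc c'" "cdisjoint c c'"
  shows "compose_sets (terms c) (terms c') = terms (ccomp c c')"
proof -
  obtain s a b t where c: "c = (s, a, b, t)" by (cases c)
  obtain a' b' u where c': "c' = (t, a', b', u)" using assms(3) c by (cases c') auto
  have dis: "disjoint_motions a a'" "disjoint_motions b b'" using assms(4) c c' by simp_all
  show ?thesis
  proof (intro equalityI subsetI)
    fix f assume "f \<in> compose_sets (terms c) (terms c')"
    then obtain d e where f: "f = d O e" and d: "d \<in> terms c" and e: "e \<in> terms c'"
      and eq: "Range d = Domain e"
      by (auto simp: compose_sets_def)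
    have sd: "d \<in> strand_diagrams" "e \<in> strand_diagrams"
      using d e unfolding c c' mem_terms_iff by simp_all
    have m: "motion_of (on_interval d PlaceP) = a" "motion_of (on_interval d PlaceQ) = b"
      "motion_of (on_interval e PlaceP) = a'" "motion_of (on_interval e PlaceQ) = b'"
      "mid_source (on_interval d PlaceP) + mid_source (on_interval d PlaceQ) = num s"
      "mid_target (on_interval e PlaceP) + mid_target (on_interval e PlaceQ) = num u"
      using d e unfolding c c' mem_terms_iff by blast+
    have RD: "Range (on_interval d x) = Domain (on_interval e x)" for x
      using eq Range_eq_Domain_iff[OF sd] by blast
    note id = on_interval_in_interval_diagrams[OF sd(1)] on_interval_in_interval_diagrams[OF sd(2)]
    have "f \<in> strand_diagrams"
      unfolding f by (rule relcomp_in_strand_diagrams[OF sd])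
    moreover have fx: "on_interval f x = on_interval d x O on_interval e x" for x
      unfolding f by (rule on_interval_relcomp[OF sd(1)])
    ultimately show "f \<in> terms (ccomp c c')"
      using interval_compose(1)[OF id _ RD, of PlaceP] interval_compose(1)[OF id _ RD, of PlaceQ] m dis
      by (simp add: c c' mem_terms_iff fx mid_source_relcomp[OF RD] mid_target_relcomp[OF RD]
         )
  next
    fix f assume f: "f \<in> terms (ccomp c c')"
    then have sd: "f \<in> strand_diagrams" unfolding c c' ccomp.simps mem_terms_iff by simp
    let ?r = "\<lambda>x. on_interval f x"
    have m: "motion_of (?r PlaceP) = join a a'" "motion_of (?r PlaceQ) = join b b'"
      "mid_source (?r PlaceP) + mid_source (?r PlaceQ) = num s"
      "mid_target (?r PlaceP) + mid_target (?r PlaceQ) = num u"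
      using f unfolding c c' ccomp.simps mem_terms_iff by blast+
    note id = on_interval_in_interval_diagrams[OF sd]
    have "mid_source (?r PlaceP) \<in> set (mid_sources (join a a'))"
      "mid_source (?r PlaceQ) \<in> set (mid_sources (join b b'))"
      using interval_motion(3)[OF id] m(1,2) by metis+
    then have fac: "factors_at a a' (mid_source (?r PlaceP))" "factors_at b b' (mid_source (?r PlaceQ))"
      using factors_at_code assms m(3) unfolding set_codes[symmetric] c c' by fastforce+
    obtain r\<^sub>1 r\<^sub>2 where r: "r\<^sub>1 \<in> interval_diagrams" "motion_of r\<^sub>1 = a"
      "r\<^sub>2 \<in> interval_diagrams" "motion_of r\<^sub>2 = a'" "Range r\<^sub>1 = Domain r\<^sub>2" "?r PlaceP = r\<^sub>1 O r\<^sub>2"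
      using interval_factor[OF id dis(1) m(1) fac(1)] .
    obtain q\<^sub>1 q\<^sub>2 where q: "q\<^sub>1 \<in> interval_diagrams" "motion_of q\<^sub>1 = b"
      "q\<^sub>2 \<in> interval_diagrams" "motion_of q\<^sub>2 = b'" "Range q\<^sub>1 = Domain q\<^sub>2" "?r PlaceQ = q\<^sub>1 O q\<^sub>2"
      using interval_factor[OF id dis(2) m(2) fac(2)] .
    define d where "d = glue (\<lambda>x. case x of PlaceP \<Rightarrow> r\<^sub>1 | PlaceQ \<Rightarrow> q\<^sub>1)"
    define e where "e = glue (\<lambda>x. case x of PlaceP \<Rightarrow> r\<^sub>2 | PlaceQ \<Rightarrow> q\<^sub>2)"
    have source: "mid_source r\<^sub>1 + mid_source q\<^sub>1 = num s"
      using m(3) r(6) q(6) mid_source_relcomp[OF r(5)] mid_source_relcomp[OF q(5)] by simp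
    have middle: "mid_target r\<^sub>1 + mid_target q\<^sub>1 = num t"
      using source assms(1) interval_motion(2)[OF r(1)] interval_motion(2)[OF q(1)] r(2) q(2)
      by (simp add: c)
    have target: "mid_target r\<^sub>2 + mid_target q\<^sub>2 = num u"
      using m(4) r(6) q(6) mid_target_relcomp[OF r(5)] mid_target_relcomp[OF q(5)] by simp
    have dt: "d \<in> terms c"
      unfolding d_def c using r q source middle by (simp add: glue_select_mem_terms_iff)
    have et: "e \<in> terms c'"
      unfolding e_def c' using r q middle target mid_target_eq_mid_source[OF r(5)]
        mid_target_eq_mid_source[OF q(5)]
      by (simp add: glue_select_mem_terms_iff)
    have sd': "d \<in> strand_diagrams" "e \<in> strand_diagrams"
      using dt et unfolding c c' mem_terms_iff by simp_all
    have "on_interval f x = on_interval d x O on_interval e x" for x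
      using r(6) q(6) by (cases x) (simp_all add: d_def e_def)
    then have fde: "f = d O e"
      by (intro strand_diagrams_eqI[OF sd relcomp_in_strand_diagrams[OF sd']])
        (simp only: on_interval_relcomp[OF sd'(1)])
    show "f \<in> compose_sets (terms c) (terms c')"
    proof (rule compose_setsI[OF dt et _ _ fde])
      show "Range d = Domain e"
        unfolding Range_eq_Domain_iff[OF sd'] all_place_iff using r(5) q(5) by (simp add: d_def e_def)
      show "inv_count (d O e) = inv_count d + inv_count e"
        using interval_compose(2)[OF r(1,3) _ r(5)] interval_compose(2)[OF q(1,3) _ q(5)]
          dis r q fde inv_count_eq[OF sd] inv_count_eq[OF sd'(1)] inv_count_eq[OF sd'(2)]
        by (simp add: d_def e_def)
    qed
  qed
qed

section \<open>Homology\<close>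

lemma finite_set_of_places [simp]: "finite (A :: place set)"
  by (rule finite_subset[OF subset_UNIV]) (simp add: UNIV_place)

lemma interval_crossing_code:
  "\<forall>r\<in>set interval_list. (crossing_number r = 1 \<longleftrightarrow> r = {(Bot, Top), (Mid, Mid)}) \<and>
     (motion_of r = Broken \<longrightarrow> r = moving Broken)"
  by code_simp

lemma crossed_interval_code:
  "{(Bot, Top), (Mid, Mid)} \<in> set interval_list \<and> motion_of {(Bot, Top), (Mid, Mid)} = Long \<and>
   mid_source {(Bot, Top), (Mid, Mid)} = 1 \<and> mid_target {(Bot, Top), (Mid, Mid)} = 1 \<and>
   crossing_number {(Bot, Top), (Mid, Mid)} = 1 \<and> crossing_number (moving Broken) = 0 \<and>
   crossing_number (moving Long) = 0 \<and>
   mid_source (moving Broken) = 1 \<and> mid_target (moving Broken) = 1 \<and>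
   mid_source (moving Long) = 0 \<and> mid_target (moving Long) = 0"
  by code_simp

abbreviation crossed_interval :: interval_diagram where
  "crossed_interval \<equiv> {(Bot, Top), (Mid, Mid)}"

lemma crossed_interval_in_interval_diagrams: "crossed_interval \<in> interval_diagrams"
  using crossed_interval_code by (simp only: set_interval_list)

lemma crossing_number_eq_1_iff:
  assumes "r \<in> interval_diagrams"
  shows "crossing_number r = 1 \<longleftrightarrow> r = crossed_interval"
  using bspec[OF interval_crossing_code[unfolded set_interval_list] assms] by blast

lemma motion_of_Broken:
  assumes "r \<in> interval_diagrams" "motion_of r = Broken"
  shows "r = moving Broken"
  using bspec[OF interval_crossing_code[unfolded set_interval_list] assms(1)] assms(2) by blast

section \<open>Resolving crossings\<close>

definition replace_at :: "place \<Rightarrow> interval_diagram \<Rightarrow> strand_diagram \<Rightarrow> strand_diagram" where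
  "replace_at x r d = glue ((on_interval d)(x := r))"

lemma replace_at_in_strand_diagrams:
  assumes "d \<in> strand_diagrams" "r \<in> interval_diagrams"
  shows "replace_at x r d \<in> strand_diagrams"
  unfolding replace_at_def
  by (rule glue_in_strand_diagrams) (simp add: assms on_interval_in_interval_diagrams)

lemma on_interval_replace_at [simp]:
  "on_interval (replace_at x r d) = (on_interval d)(x := r)"
  by (simp add: replace_at_def)

lemma replace_at_eq_iff:
  assumes "d \<in> strand_diagrams" "e \<in> strand_diagrams" "r \<in> interval_diagrams"
  shows "e = replace_at x r d \<longleftrightarrow> on_interval e x = r \<and> (\<forall>y. y \<noteq> x \<longrightarrow> on_interval e y = on_interval d y)"
proof
  assume "e = replace_at x r d"
  then show "on_interval e x = r \<and> (\<forall>y. y \<noteq> x \<longrightarrow> on_interval e y = on_interval d y)" by simp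
next
  assume *: "on_interval e x = r \<and> (\<forall>y. y \<noteq> x \<longrightarrow> on_interval e y = on_interval d y)"
  show "e = replace_at x r d"
    by (rule strand_diagrams_eqI[OF assms(2) replace_at_in_strand_diagrams[OF assms(1,3)]])
      (use * in simp)
qed

lemma resolve_eq_replace_at:
  assumes "d \<in> strand_diagrams" "on_interval d x = crossed_interval"
  shows "resolve d ((NegInf x, PosInf x), (At x, At x)) = replace_at x (moving Broken) d"
proof (rule set_eqI)
  fix z :: "point \<times> point"
  obtain u v where z: "z = (u, v)" by (cases z)
  have "(u, v) \<in> glue (on_interval d) \<longleftrightarrow>
      interval u = interval v \<and> (level_of u, level_of v) \<in> on_interval d (interval u)"
    by (simp add: glue_def)
  then have d: "(u, v) \<in> d \<longleftrightarrow>
      interval u = interval v \<and> (level_of u, level_of v) \<in> on_interval d (interval u)"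
    by (simp only: glue_on_interval[OF assms(1)])
  show "z \<in> resolve d ((NegInf x, PosInf x), (At x, At x)) \<longleftrightarrow> z \<in> replace_at x (moving Broken) d"
  proof (cases "interval u = x")
    case True
    then show ?thesis
      unfolding z resolve.simps Un_iff Diff_iff d replace_at_def glue_def
      by (cases u; cases v) (simp_all add: assms(2), blast+)
  next
    case False
    then show ?thesis
      unfolding z resolve.simps Un_iff Diff_iff d replace_at_def glue_def
      by (cases u; cases v) auto
  qed
qed

text \<open>The relation \<open>moving Broken\<close> has no crossing and the other interval is
  untouched. So every resolution lowers the count by exactly one, and all resolutions contribute to
  the boundary.\<close>

lemma inv_count_replace_at:
  assumes "d \<in> strand_diagrams" "on_interval d x = crossed_interval"
  shows "inv_count (replace_at x (moving Broken) d) + 1 = inv_count d"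
  using assms crossed_interval_code
  by (cases x) (simp_all add: inv_count_eq replace_at_in_strand_diagrams del: moving.simps)

lemma sd_boundary_apply:
  assumes d: "d \<in> strand_diagrams"
  shows "sd_boundary d f =
    (\<Sum>x\<in>{x. on_interval d x = crossed_interval}. if f = replace_at x (moving Broken) d then 1 else 0)"
proof -
  let ?X = "{x. on_interval d x = crossed_interval}"
  let ?c = "\<lambda>x. ((NegInf x, PosInf x), (At x, At x))"
  have X: "{x. crossing_number (on_interval d x) = 1} = ?X"
    using crossing_number_eq_1_iff[OF on_interval_in_interval_diagrams[OF d]] by blast
  have "{c \<in> crossings d. inv_count (resolve d c) + 1 = inv_count d} = ?c ` ?X"
    unfolding crossings_eq[OF d] X
    using resolve_eq_replace_at[OF d] inv_count_replace_at[OF d] by auto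
  moreover have "inj_on ?c ?X" by (auto simp: inj_on_def)
  ultimately have "sd_boundary d = (\<Sum>x\<in>?X. single (resolve d (?c x)))"
    unfolding sd_boundary_def by (simp only: sum.reindex o_def)
  also have "\<dots> = (\<Sum>x\<in>?X. single (replace_at x (moving Broken) d))"
    by (rule sum.cong) (simp_all only: resolve_eq_replace_at[OF d] mem_Collect_eq)
  finally show ?thesis by (simp only: sum_fun_apply single_def)
qed

lemma boundary_apply: "boundary a f = (\<Sum>d\<in>strand_diagrams. a d * sd_boundary d f)"
  by (simp add: boundary_def sum_fun_apply scale_def)

lemma boundary_ind_apply:
  assumes "A \<subseteq> strand_diagrams"
  shows "boundary (ind A) f = (\<Sum>d\<in>A. sd_boundary d f)"
  unfolding boundary_apply using assms
  by (intro sum.mono_neutral_cong_right) (auto simp: ind_def)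

lemma terms_subset: "terms c \<subseteq> strand_diagrams"
  using same_moving_terms by (simp add: same_moving_def)

text \<open>Resolving a crossing turns a long strand into a broken one.\<close>

lemma boundary_apply_eq_0:
  assumes "\<And>x. on_interval f x \<noteq> moving Broken"
  shows "boundary a f = 0"
proof -
  have neq: "f \<noteq> replace_at x (moving Broken) d" for x d
    using assms[of x] by (metis fun_upd_same on_interval_replace_at)
  have "sd_boundary d f = 0" if "d \<in> strand_diagrams" for d
    unfolding sd_boundary_apply[OF that] by (simp only: neq if_False sum.neutral_const)
  then show ?thesis unfolding boundary_apply by (simp add: sum.neutral)
qed

text \<open>Test terms for the two tight diagrams with one broken and one long strand. The place of
  the broken interval is already occupied, so the other interval has no horizontal strand at its
  place.\<close>

definition broken_long :: "place \<Rightarrow> strand_diagram" where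
  "broken_long x = glue (\<lambda>y. if y = x then moving Broken else moving Long)"

definition crossed_long :: "place \<Rightarrow> strand_diagram" where
  "crossed_long x = glue (\<lambda>y. if y = x then crossed_interval else moving Long)"

lemma broken_long_in_strand_diagrams: "broken_long x \<in> strand_diagrams"
  unfolding broken_long_def by (rule glue_in_strand_diagrams) (simp del: moving.simps)

lemma crossed_long_in_strand_diagrams: "crossed_long x \<in> strand_diagrams"
  unfolding crossed_long_def
  by (rule glue_in_strand_diagrams) (simp add: crossed_interval_in_interval_diagrams del: moving.simps)

text \<open>A resolution can be undone only on an interval whose strand is broken, here only on that
  of \<open>x\<close>. Thus \<open>crossed_long x\<close> is the one strand diagram whose boundary
  contains \<open>broken_long x\<close>.\<close>

lemma boundary_broken_long: "boundary a (broken_long x) = a (crossed_long x)"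
proof -
  have neq: "moving Broken \<noteq> moving Long" "crossed_interval \<noteq> moving Long" by auto
  have "sd_boundary d (broken_long x) = (if d = crossed_long x then 1 else 0)"
    if d: "d \<in> strand_diagrams" for d
  proof -
    have iff: "on_interval d y = crossed_interval \<and> broken_long x = replace_at y (moving Broken) d \<longleftrightarrow>
        y = x \<and> d = crossed_long x" for y
    proof
      assume *: "on_interval d y = crossed_interval \<and> broken_long x = replace_at y (moving Broken) d"
      then have **: "on_interval (broken_long x) z = (if z = y then moving Broken else on_interval d z)" for z
        by (simp del: moving.simps)
      have "y = x"
        using **[of y] neq(1) unfolding broken_long_def on_interval_glue by (metis (full_types))
      moreover have "d = crossed_long x"
      proof (rule strand_diagrams_eqI[OF d crossed_long_in_strand_diagrams])
        fix z show "on_interval d z = on_interval (crossed_long x) z"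
          using **[of z] * \<open>y = x\<close> unfolding broken_long_def crossed_long_def on_interval_glue
          by (cases "z = x") simp_all
      qed
      ultimately show "y = x \<and> d = crossed_long x" by blast
    next
      assume "y = x \<and> d = crossed_long x"
      then show "on_interval d y = crossed_interval \<and> broken_long x = replace_at y (moving Broken) d"
        using replace_at_eq_iff[OF crossed_long_in_strand_diagrams broken_long_in_strand_diagrams]
        by (simp add: broken_long_def crossed_long_def del: moving.simps)
    qed
    have "sd_boundary d (broken_long x) = (if \<exists>y\<in>{y. on_interval d y = crossed_interval}.
        broken_long x = replace_at y (moving Broken) d then 1 else 0)"
      unfolding sd_boundary_apply[OF d]
    proof (rule sum_bit_unique)
      fix y z
      assume "y \<in> {y. on_interval d y = crossed_interval}" "z \<in> {y. on_interval d y = crossed_interval}"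
        "broken_long x = replace_at y (moving Broken) d" "broken_long x = replace_at z (moving Broken) d"
      then show "y = z" using iff[of y] iff[of z] by blast
    qed simp
    also have "(\<exists>y\<in>{y. on_interval d y = crossed_interval}.
        broken_long x = replace_at y (moving Broken) d) \<longleftrightarrow> d = crossed_long x"
      by (simp only: Bex_def mem_Collect_eq iff) simp
    finally show ?thesis .
  qed
  then have "boundary a (broken_long x) =
      (\<Sum>d\<in>strand_diagrams. if d = crossed_long x then a d else 0)"
    unfolding boundary_apply by (intro sum.cong) simp_all
  then show ?thesis using crossed_long_in_strand_diagrams by simp
qed

text \<open>
  \<open>crossed_long PlaceP\<close> and \<open>crossed_long PlaceQ\<close> occur only in the diagram of a long strand on both
  intervals with a dotted pair, whose boundary is therefore the sum of two tight diagrams and never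
  one of them alone.
\<close>

lemma strand_algebra_crossed_long:
  assumes "a \<in> strand_algebra"
  shows "a (crossed_long PlaceP) = a (crossed_long PlaceQ)"
  using assms unfolding strand_algebra_def
proof (induction rule: strand.span_induct_alt)
  case (step r D a)
  obtain c where c: "D = dgm c" using step(1) is_diagram_iff by auto
  obtain s a b t where "c = (s, a, b, t)" by (cases c)
  then have "D (crossed_long PlaceP) = D (crossed_long PlaceQ)"
    using crossed_long_in_strand_diagrams crossed_interval_code
    by (simp add: c dgm_eq_ind ind_def mem_terms_iff crossed_long_def del: moving.simps)
  then show ?case using step by (simp add: scale_def)
qed simp

section \<open>Crossed, twisted and tight diagrams\<close>

fun crossed :: "code \<Rightarrow> bool" where
  "crossed (s, a, b, t) \<longleftrightarrow> s \<and> t \<and> (a, b) \<in> {(Long, Still), (Still, Long), (Long, Long)}"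

fun twisted :: "code \<Rightarrow> bool" where
  "twisted (s, a, b, t) \<longleftrightarrow> s \<and> t \<and> (a, b) \<in> {(Broken, Still), (Still, Broken)}"

fun tight :: "code \<Rightarrow> bool" where
  "tight c \<longleftrightarrow> \<not> crossed c \<and> \<not> twisted c"

lemma crossings_nonempty_iff:
  assumes "d \<in> strand_diagrams"
  shows "crossings d \<noteq> {} \<longleftrightarrow> (\<exists>x. on_interval d x = crossed_interval)"
  unfolding crossings_eq[OF assms]
  using crossing_number_eq_1_iff[OF on_interval_in_interval_diagrams[OF assms]] by blast

lemma has_crossing_dgm_iff:
  "has_crossing (dgm c) \<longleftrightarrow> (\<exists>d\<in>terms c. \<exists>x. on_interval d x = crossed_interval)"
  using terms_subset[of c] crossings_nonempty_iff
  unfolding has_crossing_def dgm_eq_ind ind_def by (metis subsetD zero_neq_one)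

lemma has_crossing_dgm:
  assumes "valid c"
  shows "has_crossing (dgm c) \<longleftrightarrow> crossed c"
proof -
  obtain s a b t where c: "c = (s, a, b, t)" by (cases c)
  show ?thesis
  proof
    assume "has_crossing (dgm c)"
    then obtain d x where d: "d \<in> terms (s, a, b, t)" and x: "on_interval d x = crossed_interval"
      unfolding has_crossing_dgm_iff c by blast
    have sd: "d \<in> strand_diagrams" using d unfolding mem_terms_iff by simp
    note id = on_interval_in_interval_diagrams[OF sd]
    \<comment> \<open>The horizontal strand in the crossing uses up both idempotents, so the place
      on the other interval is empty in source and target, which leaves \<open>Still\<close> or
      \<open>Long\<close> there.\<close>
    have b: "b \<in> {Still, Long}" if "mid_source (on_interval d y) = 0" "mid_target (on_interval d y) = 0"
      "motion_of (on_interval d y) = b" for y b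
      using interval_motion(2,3)[OF id[of y]] that
      by (cases b) (simp_all add: arrivals.simps departures.simps)
    show "crossed c"
      using d x b[of PlaceP a] b[of PlaceQ b] crossed_interval_code unfolding mem_terms_iff c
      by (cases x) (auto simp: num.simps split: if_splits)
  next
    assume "crossed c"
    then have c': "s" "t" "(a, b) \<in> {(Long, Still), (Still, Long), (Long, Long)}" using c by auto
    have "mid_source (moving Still) = 0" "mid_target (moving Still) = 0"
      by (simp_all add: mid_source_def mid_target_def)
    moreover have "glue (\<lambda>x. case x of PlaceP \<Rightarrow> crossed_interval | PlaceQ \<Rightarrow> moving b) \<in> terms c"
      if "a = Long" "b \<in> {Still, Long}"
      unfolding c glue_select_mem_terms_iff[OF crossed_interval_in_interval_diagrams moving_in_interval_diagrams]
      using that crossed_interval_code calculation c' by (auto simp: num.simps simp del: moving.simps)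
    moreover have "glue (\<lambda>x. case x of PlaceP \<Rightarrow> moving a | PlaceQ \<Rightarrow> crossed_interval) \<in> terms c"
      if "b = Long" "a \<in> {Still, Long}"
      unfolding c glue_select_mem_terms_iff[OF moving_in_interval_diagrams crossed_interval_in_interval_diagrams]
      using that crossed_interval_code calculation c' by (auto simp: num.simps simp del: moving.simps)
    ultimately show "has_crossing (dgm c)"
      unfolding has_crossing_dgm_iff using c'(3) on_interval_glue
      by (metis (no_types, lifting) insert_iff Pair_inject place.case(1,2) singletonD)
  qed
qed

lemma dgm_in_strand_algebra: "valid c \<Longrightarrow> dgm c \<in> strand_algebra"
  unfolding strand_algebra_def using is_diagram_iff by (intro strand.span_base) blast

definition code_at :: "place \<Rightarrow> motion \<Rightarrow> code" where
  "code_at x m = (case x of PlaceP \<Rightarrow> (True, m, Still, True) | PlaceQ \<Rightarrow> (True, Still, m, True))"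

lemma mem_terms_code_at_iff:
  assumes "y \<noteq> x"
  shows "d \<in> terms (code_at x m) \<longleftrightarrow> d \<in> strand_diagrams \<and>
     motion_of (on_interval d x) = m \<and> motion_of (on_interval d y) = Still \<and>
     mid_source (on_interval d x) + mid_source (on_interval d y) = 1 \<and>
     mid_target (on_interval d x) + mid_target (on_interval d y) = 1"
  using assms by (cases x; cases y) (auto simp: code_at_def mem_terms_iff num.simps)

text \<open>Terms without a horizontal strand at \<open>x\<close> have no crossing and contribute
  nothing. On the remaining terms resolution is a bijection onto the terms of the broken diagram;
  the inverse puts the crossing back, which is possible because \<open>Broken\<close> determines the
  relation on its interval completely.\<close>

lemma boundary_code_at_Long: "boundary (dgm (code_at x Long)) = dgm (code_at x Broken)"
proof
  fix f
  obtain y where y: "y \<noteq> x" "\<And>z. z \<noteq> x \<longleftrightarrow> z = y"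
    by (metis place.distinct(1) place.exhaust)
  let ?A = "terms (code_at x Long)"
  let ?P = "\<lambda>d. on_interval d x = crossed_interval \<and> f = replace_at x (moving Broken) d"
  have sub: "?A \<subseteq> strand_diagrams" by (rule terms_subset)
  have "sd_boundary d f = (if ?P d then 1 else 0)" if "d \<in> ?A" for d
  proof -
    have "motion_of (on_interval d y) \<noteq> Long" using that mem_terms_code_at_iff[OF y(1)] by simp
    then have "on_interval d y \<noteq> crossed_interval" using crossed_interval_code by metis
    then have eq: "on_interval d z = crossed_interval \<longleftrightarrow> z = x \<and> on_interval d x = crossed_interval" for z
      using y(2)[of z] by metis
    have "{z. on_interval d z = crossed_interval} =
        (if on_interval d x = crossed_interval then {x} else {})"
    proof (rule set_eqI)
      fix z
      show "z \<in> {z. on_interval d z = crossed_interval} \<longleftrightarrow>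
          z \<in> (if on_interval d x = crossed_interval then {x} else {})"
        using eq[of z] by (cases "z = x") simp_all
    qed
    moreover have "d \<in> strand_diagrams" using that sub by blast
    ultimately show ?thesis by (simp add: sd_boundary_apply del: moving.simps)
  qed
  then have "boundary (dgm (code_at x Long)) f = (\<Sum>d\<in>?A. if ?P d then 1 else 0)"
    unfolding dgm_eq_ind boundary_ind_apply[OF sub] by (intro sum.cong) simp_all
  also have "\<dots> = (if \<exists>d\<in>?A. ?P d then 1 else 0)"
  proof (rule sum_bit_unique)
    fix d e assume de: "d \<in> ?A" "e \<in> ?A" "?P d" "?P e"
    have sd: "d \<in> strand_diagrams" "e \<in> strand_diagrams" using de sub by blast+
    have "on_interval d z = on_interval e z" for z
    proof (cases "z = x")
      case False
      have "f = replace_at x (moving Broken) d" "f = replace_at x (moving Broken) e"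
        using de(3,4) by blast+
      then have "on_interval f z = on_interval d z" "on_interval f z = on_interval e z"
        using False by (metis fun_upd_other on_interval_replace_at)+
      then show ?thesis by simp
    qed (use de in simp)
    then show "d = e" by (rule strand_diagrams_eqI[OF sd])
  qed simp
  also have "(\<exists>d\<in>?A. ?P d) \<longleftrightarrow> f \<in> terms (code_at x Broken)"
  proof
    assume "\<exists>d\<in>?A. ?P d"
    then obtain d where d: "d \<in> ?A" "on_interval d x = crossed_interval"
      and f: "f = replace_at x (moving Broken) d" by blast
    have sd: "d \<in> strand_diagrams" using d sub by blast
    show "f \<in> terms (code_at x Broken)"
      using d y(1) crossed_interval_code replace_at_in_strand_diagrams[OF sd moving_in_interval_diagrams]
      unfolding mem_terms_code_at_iff[OF y(1)] f by (simp del: moving.simps)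
  next
    assume f: "f \<in> terms (code_at x Broken)"
    then have sd: "f \<in> strand_diagrams" using terms_subset by blast
    note id = on_interval_in_interval_diagrams[OF sd]
    let ?d = "replace_at x crossed_interval f"
    have fx: "on_interval f x = moving Broken"
      using f motion_of_Broken[OF id] unfolding mem_terms_code_at_iff[OF y(1)] by blast
    have "?d \<in> ?A"
      using f y(1) fx crossed_interval_code
        replace_at_in_strand_diagrams[OF sd crossed_interval_in_interval_diagrams]
      unfolding mem_terms_code_at_iff[OF y(1)] by (simp del: moving.simps)
    moreover have "f = replace_at x (moving Broken) ?d"
      using replace_at_eq_iff[OF replace_at_in_strand_diagrams[OF sd
          crossed_interval_in_interval_diagrams] sd moving_in_interval_diagrams] fx
      by (simp del: moving.simps)
    ultimately show "\<exists>d\<in>?A. ?P d" by (intro bexI[of _ ?d]) (simp_all del: moving.simps)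
  qed
  finally show "boundary (dgm (code_at x Long)) f = dgm (code_at x Broken) f"
    by (simp add: dgm_eq_ind ind_def)
qed

lemma zero_in_homology_twisted:
  assumes "twisted c"
  shows "zero_in_homology (dgm c)"
proof -
  obtain s a b t where c: "c = (s, a, b, t)" by (cases c)
  obtain x where x: "c = code_at x Broken"
  proof (cases "a = Broken")
    case True
    then show ?thesis using that[of PlaceP] assms by (simp add: c code_at_def)
  next
    case False
    then show ?thesis using that[of PlaceQ] assms by (simp add: c code_at_def)
  qed
  have "valid (code_at x Long)"
    by (cases x) (simp_all add: code_at_def num.simps arrivals.simps departures.simps)
  then show ?thesis
    unfolding zero_in_homology_def x boundary_code_at_Long[symmetric]
    by (intro imageI dgm_in_strand_algebra)
qed

lemma nonzero_in_homology_tight: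
  assumes c: "valid c" "tight c"
  shows "nonzero_in_homology (dgm c)"
proof -
  have "sd_boundary d f = 0" if "d \<in> terms c" for d f
  proof -
    have "{x. on_interval d x = crossed_interval} = {}"
      using that has_crossing_dgm[OF c(1)] c(2) unfolding has_crossing_dgm_iff by auto
    moreover have "d \<in> strand_diagrams" using that terms_subset by blast
    ultimately show ?thesis by (simp only: sd_boundary_apply sum.empty)
  qed
  then have "boundary (dgm c) = 0"
    unfolding dgm_eq_ind by (intro ext) (simp add: boundary_ind_apply[OF terms_subset])
  moreover have "dgm c \<noteq> boundary a" if a: "a \<in> strand_algebra" for a
  proof
    assume eq: "dgm c = boundary a"
    obtain s m n t where smnt: "c = (s, m, n, t)" by (cases c)
    \<comment> \<open>A broken strand requires both idempotents to be on and leaves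
      \<open>Still\<close> or \<open>Long\<close> on the other interval; \<open>Still\<close> is the
      twisted case.\<close>
    have "c \<in> {(True, Broken, Long, True), (True, Long, Broken, True)} \<or> m \<noteq> Broken \<and> n \<noteq> Broken"
      using c unfolding smnt set_codes[symmetric] by (auto simp: codes_def)
    then show False
    proof
      assume c': "c \<in> {(True, Broken, Long, True), (True, Long, Broken, True)}"
      \<comment> \<open>A boundary has equal coefficients at the two test terms, whereas each of
        these two diagrams contains exactly one of them.\<close>
      have "broken_long PlaceP \<in> terms c \<longleftrightarrow> broken_long PlaceQ \<in> terms c"
        using strand_algebra_crossed_long[OF a] boundary_broken_long[of a]
        unfolding eq[symmetric] dgm_eq_ind ind_def by (metis zero_neq_one)
      then show False
        using c' broken_long_in_strand_diagrams crossed_interval_code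
        by (auto simp: mem_terms_iff broken_long_def num.simps simp del: moving.simps)
    next
      assume mn: "m \<noteq> Broken \<and> n \<noteq> Broken"
      obtain d where d: "d \<in> terms c" using c(1) terms_nonempty_iff by blast
      then have "motion_of (on_interval d x) \<noteq> Broken" for x
        using mn unfolding smnt mem_terms_iff by (cases x) auto
      then have "on_interval d x \<noteq> moving Broken" for x by (metis motion_of_moving)
      then have "boundary a d = 0" by (rule boundary_apply_eq_0)
      then show False using d unfolding eq[symmetric] dgm_eq_ind ind_def by simp
    qed
  qed
  ultimately show ?thesis
    unfolding nonzero_in_homology_def using dgm_in_strand_algebra[OF c(1)] by blast
qed

lemma tight_diagram_dgm:
  assumes "valid c"
  shows "tight_diagram (dgm c) \<longleftrightarrow> tight c"
proof -
  have "\<not> nonzero_in_homology D" if "zero_in_homology D" for D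
    using that by (simp add: zero_in_homology_def nonzero_in_homology_def)
  then show ?thesis
    unfolding tight_diagram_def has_crossing_dgm[OF assms]
    using nonzero_in_homology_tight[OF assms] zero_in_homology_twisted[of c] tight.simps[of c] by metis
qed

lemma twisted_diagram_dgm:
  assumes "valid c" "twisted c"
  shows "twisted_diagram (dgm c)"
proof -
  have "\<not> crossed c" using assms(2) by (cases c) auto
  then show ?thesis
    using assms by (simp add: twisted_diagram_def has_crossing_dgm zero_in_homology_twisted)
qed

section \<open>Tensor products of codes\<close>

declare dgm.simps [simp del] valid.simps [simp del] tight.simps [simp del]

text \<open>Quantifiers over steps range over this list wherever a statement is to be
  evaluated.\<close>

definition steps :: "step list" where
  "steps = [Before PlaceP, After PlaceP, Before PlaceQ, After PlaceQ]"

lemma mem_steps [simp]: "z \<in> set steps"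
proof (cases z)
  case (Before x)
  then show ?thesis by (cases x) (simp_all add: steps_def)
next
  case (After x)
  then show ?thesis by (cases x) (simp_all add: steps_def)
qed

definition covers :: "code list \<Rightarrow> step \<Rightarrow> nat" where
  "covers cs z = (\<Sum>c\<leftarrow>cs. cover c z)"

definition cviable :: "code list \<Rightarrow> bool" where
  "cviable cs \<longleftrightarrow> cs \<noteq> [] \<and> (\<forall>c\<in>set cs. valid c) \<and>
     successively (\<lambda>c d. ctgt c = csrc d) cs \<and> (\<forall>z\<in>set steps. covers cs z \<le> 1)"

text \<open>\<open>None\<close> stands for a zero product; the nesting to the right is that of
  \<open>product\<close>.\<close>

fun cprod :: "code list \<Rightarrow> code option" where
  "cprod [] = None"
| "cprod [c] = Some c"
| "cprod (c # d # cs) = (case cprod (d # cs) of None \<Rightarrow> None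
     | Some e \<Rightarrow> if valid (ccomp c e) then Some (ccomp c e) else None)"

lemma covers_simps [simp]: "covers [] z = 0" "covers (c # cs) z = cover c z + covers cs z"
  by (simp_all add: covers_def)

lemma cdisjoint_iff: "cdisjoint c d \<longleftrightarrow> (\<forall>z\<in>set steps. cover c z + cover d z \<le> 1)"
  by (cases c; cases d) (auto simp: steps_def num.simps disjoint_motions_def)

lemma cover_ccomp:
  assumes "cdisjoint c d"
  shows "cover (ccomp c d) z = cover c z + cover d z"
proof -
  have join: "num (before (join m n)) = num (before m) + num (before n)"
    "num (after (join m n)) = num (after m) + num (after n)" if "disjoint_motions m n" for m n
    using that by (cases m; cases n; simp add: disjoint_motions_def num.simps)+
  obtain s a b t s' a' b' t' where cd: "c = (s, a, b, t)" "d = (s', a', b', t')"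
    by (metis surj_pair)
  show ?thesis
  proof (cases z)
    case (Before x)
    then show ?thesis using assms join by (cases x) (simp_all add: cd)
  next
    case (After x)
    then show ?thesis using assms join by (cases x) (simp_all add: cd)
  qed
qed

lemma cviable_Cons:
  assumes "cviable (c # d # cs)"
  shows "cviable (d # cs)" "valid c" "ctgt c = csrc d"
  using assms unfolding cviable_def by (auto intro: order_trans[rotated])

lemma cprod_Some:
  assumes "cviable cs" "cprod cs = Some e"
  shows "valid e \<and> csrc e = csrc (hd cs) \<and> ctgt e = ctgt (last cs) \<and> (\<forall>z. cover e z = covers cs z)"
  using assms
proof (induction cs arbitrary: e rule: cprod.induct)
  case (2 c)
  then show ?case by (simp add: cviable_def)
next
  case (3 c d cs)
  obtain e' where e': "cprod (d # cs) = Some e'" "e = ccomp c e'" "valid e"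
    using 3(3) by (auto split: option.splits if_splits)
  have IH: "valid e' \<and> csrc e' = csrc d \<and> ctgt e' = ctgt (last (d # cs)) \<and>
      (\<forall>z. cover e' z = covers (d # cs) z)"
    using 3(1)[OF cviable_Cons(1)[OF 3(2)] e'(1)] by simp
  have "cdisjoint c e'"
    using 3(2) IH unfolding cviable_def cdisjoint_iff by simp
  then have "\<forall>z. cover e z = covers (c # d # cs) z"
    using IH by (simp add: e'(2) cover_ccomp)
  moreover have "csrc e = csrc c" "ctgt e = ctgt e'"
    unfolding e'(2) by (cases c; cases e'; simp)+
  ultimately show ?case using IH e'(3) by simp
qed simp

lemma cdisjoint_cprod:
  assumes "cviable (c # d # cs)" "cprod (d # cs) = Some e"
  shows "cdisjoint c e"
  using cprod_Some[OF cviable_Cons(1)[OF assms(1)] assms(2)] assms(1)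
  unfolding cviable_def cdisjoint_iff by simp

lemma product_dgm:
  assumes "cviable cs"
  shows "product (map dgm cs) = (case cprod cs of None \<Rightarrow> 0 | Some e \<Rightarrow> dgm e)"
  using assms
proof (induction cs rule: cprod.induct)
  case (3 c d cs)
  note v = cviable_Cons[OF 3(2)]
  have IH: "product (map dgm (d # cs)) = (case cprod (d # cs) of None \<Rightarrow> 0 | Some e \<Rightarrow> dgm e)"
    using 3(1)[OF v(1)] .
  show ?case
  proof (cases "cprod (d # cs)")
    case None
    then show ?thesis using IH by (simp add: odot_zero_right)
  next
    case (Some e)
    have e: "valid e" "csrc e = csrc d" using cprod_Some[OF v(1) Some] by simp_all
    have "dgm c \<odot> dgm e = ind (terms (ccomp c e))"
      unfolding dgm_eq_ind mult_ind[OF same_moving_terms same_moving_terms]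
      using compose_terms[OF v(2) e(1) _ cdisjoint_cprod[OF 3(2) Some]] v(3) e(2) by simp
    \<comment> \<open>A composite that is not valid has no terms, so its product is
      \<open>0\<close>, in agreement with \<open>None\<close>.\<close>
    also have "\<dots> = (if valid (ccomp c e) then dgm (ccomp c e) else 0)"
      using terms_nonempty_iff[of "ccomp c e"] by (auto simp: dgm_eq_ind)
    finally show ?thesis using IH Some by (simp add: zero_fun_def)
  qed
qed (simp_all add: cviable_def)

lemma viable_imp_cviable:
  assumes "viable Ds"
  obtains cs where "Ds = map dgm cs" "cviable cs"
proof -
  have "\<forall>D\<in>set Ds. \<exists>c. valid c \<and> D = dgm c"
    using assms is_diagram_iff unfolding viable_def by blast
  then obtain f where f: "\<And>D. D \<in> set Ds \<Longrightarrow> valid (f D) \<and> D = dgm (f D)" by metis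
  define cs where "cs = map f Ds"
  have Ds: "Ds = map dgm cs" unfolding cs_def using f by (simp add: map_idI)
  have val: "\<forall>c\<in>set cs. valid c" using f by (auto simp: cs_def)
  have "covers cs z = (\<Sum>D\<leftarrow>Ds. h_of D z)" for z
    unfolding covers_def Ds map_map o_def
    by (intro arg_cong[of _ _ sum_list] map_cong) (use val in \<open>simp_all\<close>)
  then have "\<forall>z\<in>set steps. covers cs z \<le> 1" using assms by (simp add: viable_def)
  moreover have "successively (\<lambda>c d. ctgt c = csrc d) cs"
  proof -
    have "ctgt (cs ! i) = csrc (cs ! Suc i)" if "Suc i < length cs" for i
    proof -
      have "tgt (Ds ! i) = src (Ds ! Suc i)" using assms that by (simp add: viable_def Ds)
      then show ?thesis using that val by (simp add: Ds)
    qed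
    then show ?thesis by (simp add: successively_conv_nth)
  qed
  moreover have "cs \<noteq> []" using assms by (simp add: viable_def Ds)
  ultimately have "cviable cs" using val by (simp add: cviable_def)
  then show ?thesis using that Ds by blast
qed

lemma tensor_hdata_dgm:
  assumes "cviable cs"
  shows "tensor_hdata (map dgm cs) = (covers cs, csrc (hd cs), ctgt (last cs))"
proof -
  have val: "\<forall>c\<in>set cs. valid c" and ne: "cs \<noteq> []" using assms by (simp_all add: cviable_def)
  have "(\<Sum>D\<leftarrow>map dgm cs. h_of D z) = covers cs z" for z
    unfolding covers_def map_map o_def
    by (intro arg_cong[of _ _ sum_list] map_cong) (use val in \<open>simp_all\<close>)
  then show ?thesis
    using ne val unfolding tensor_hdata_def by (simp add: hd_map last_map del: map_map)
qed

text \<open>Evaluable form of the summand being nonzero: it is spanned by diagrams, which are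
  nonzero, so one diagram with these H-data decides.\<close>

definition has_summand :: "(step \<Rightarrow> nat) \<Rightarrow> bool \<Rightarrow> bool \<Rightarrow> bool" where
  "has_summand h s t \<longleftrightarrow> (\<exists>c\<in>set codes. csrc c = s \<and> ctgt c = t \<and> (\<forall>z\<in>set steps. cover c z = h z))"

lemma summand_nonzero_iff: "summand (h, s, t) \<noteq> {0} \<longleftrightarrow> has_summand h s t"
proof
  assume "summand (h, s, t) \<noteq> {0}"
  then have "{D. has_hdata D (h, s, t)} \<noteq> {}" unfolding summand_def by auto
  then obtain c where "valid c" "(h, s, t) = (cover c, csrc c, ctgt c)"
    unfolding has_hdata_iff by blast
  then show "has_summand h s t" unfolding has_summand_def by (intro bexI[of _ c]) (simp_all add: set_codes)
next
  assume "has_summand h s t"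
  then obtain c where c: "valid c" "csrc c = s" "ctgt c = t" "\<forall>z\<in>set steps. cover c z = h z"
    unfolding has_summand_def set_codes Bex_def by blast
  have "h = cover c" using c(4) by (intro ext) simp
  with c have "has_hdata (dgm c) (h, s, t)" unfolding has_hdata_iff by blast
  then have "dgm c \<in> summand (h, s, t)" unfolding summand_def by (intro strand.span_base) simp
  moreover have "dgm c \<noteq> 0" using c(1) dgm_nonzero_iff by blast
  ultimately show "summand (h, s, t) \<noteq> {0}" by blast
qed

fun ctightness :: "code list \<Rightarrow> tightness \<Rightarrow> bool" where
  "ctightness cs Tight \<longleftrightarrow> (case cprod cs of None \<Rightarrow> False | Some e \<Rightarrow> tight e) \<and> (\<forall>c\<in>set cs. tight c)"
| "ctightness cs Sublime \<longleftrightarrow> (case cprod cs of None \<Rightarrow> False | Some e \<Rightarrow> tight e) \<and> \<not> (\<forall>c\<in>set cs. tight c)"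
| "ctightness cs Twisted \<longleftrightarrow> (case cprod cs of None \<Rightarrow> False | Some e \<Rightarrow> twisted e)"
| "ctightness cs Crossed \<longleftrightarrow> (case cprod cs of None \<Rightarrow> False | Some e \<Rightarrow> crossed e)"
| "ctightness cs Critical \<longleftrightarrow> cprod cs = None \<and> has_summand (covers cs) (csrc (hd cs)) (ctgt (last cs))"
| "ctightness cs Singular \<longleftrightarrow> \<not> has_summand (covers cs) (csrc (hd cs)) (ctgt (last cs))"

lemma has_tightness_dgm:
  assumes cs: "cviable cs" and "ctightness cs \<tau>"
  shows "has_tightness (map dgm cs) \<tau>"
proof -
  have val: "\<forall>c\<in>set cs. valid c" using cs by (simp add: cviable_def)
  have all: "(\<forall>D\<in>set (map dgm cs). tight_diagram D) \<longleftrightarrow> (\<forall>c\<in>set cs. tight c)"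
    using val tight_diagram_dgm by simp
  have some: "\<exists>e. valid e \<and> product (map dgm cs) = dgm e \<and> dgm e \<noteq> 0 \<and> P e"
    if P: "case cprod cs of None \<Rightarrow> False | Some e \<Rightarrow> P e" for P
  proof -
    obtain e where e: "cprod cs = Some e" "P e" using P by (cases "cprod cs") simp_all
    then show ?thesis
      using cprod_Some[OF cs e(1)] product_dgm[OF cs] dgm_nonzero_iff[of e] by (intro exI[of _ e]) simp
  qed
  show ?thesis
  proof (cases \<tau>)
    case Tight
    then show ?thesis using assms(2) some[of tight] all tight_diagram_dgm by auto
  next
    case Sublime
    then show ?thesis using assms(2) some[of tight] all tight_diagram_dgm by auto
  next
    case Twisted
    then show ?thesis using assms(2) some[of twisted] twisted_diagram_dgm by auto
  next
    case Crossed
    then show ?thesis using assms(2) some[of crossed] has_crossing_dgm by auto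
  next
    case Critical
    then show ?thesis
      using assms(2) product_dgm[OF cs] summand_nonzero_iff tensor_hdata_dgm[OF cs] by simp
  next
    case Singular
    then show ?thesis
      using assms(2) summand_nonzero_iff[of "covers cs" "csrc (hd cs)" "ctgt (last cs)"]
        tensor_hdata_dgm[OF cs] by simp
  qed
qed

subsection \<open>Removing idempotents\<close>

fun idle :: "code \<Rightarrow> bool" where
  "idle (s, a, b, t) \<longleftrightarrow> a = Still \<and> b = Still"

lemma idle_valid: "idle c \<Longrightarrow> valid c \<Longrightarrow> c = (csrc c, Still, Still, csrc c)"
  by (cases c) (auto simp: valid.simps arrivals.simps departures.simps)

lemma cover_idle: "idle c \<Longrightarrow> cover c z = 0"
  by (cases c; cases z; rename_tac x; case_tac x) (auto simp: num.simps)

lemma ccomp_idle_left: "idle c \<Longrightarrow> valid c \<Longrightarrow> ctgt c = csrc d \<Longrightarrow> ccomp c d = d"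
  using idle_valid[of c] by (cases c; cases d) auto

lemma ccomp_idle_right: "idle d \<Longrightarrow> valid d \<Longrightarrow> ctgt c = csrc d \<Longrightarrow> ccomp c d = c"
proof -
  have "join m Still = m" for m by (cases m) auto
  then show "idle d \<Longrightarrow> valid d \<Longrightarrow> ctgt c = csrc d \<Longrightarrow> ccomp c d = c"
    using idle_valid[of d] by (cases c; cases d) auto
qed

lemma tight_idle: "idle c \<Longrightarrow> tight c"
  by (cases c) (auto simp: tight.simps)

abbreviation busy :: "code list \<Rightarrow> code list" where
  "busy \<equiv> filter (\<lambda>c. \<not> idle c)"

lemma covers_busy: "covers (busy cs) z = covers cs z"
  by (induction cs) (simp_all add: cover_idle)

lemma all_idle:
  assumes "cviable cs" "busy cs = []"
  shows "cprod cs = Some (hd cs) \<and> ctgt (last cs) = ctgt (hd cs)"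
  using assms
proof (induction cs rule: cprod.induct)
  case (3 c d cs)
  note v = cviable_Cons[OF 3(2)]
  have idle: "idle c" "idle d" "valid d" "busy (d # cs) = []"
    using 3(3) v(1) by (auto simp: cviable_def split: if_splits)
  then have "cprod (d # cs) = Some d" "ctgt (last (d # cs)) = ctgt d"
    using 3(1)[OF v(1)] by simp_all
  moreover have "ccomp c d = c" using ccomp_idle_right[OF idle(2,3) v(3)] .
  moreover have "ctgt d = ctgt c"
    using idle_valid[OF idle(1) v(2)] idle_valid[OF idle(2,3)] v(3) by (metis csrc.simps ctgt.simps)
  ultimately show ?case using v(2) by simp
qed (simp_all add: cviable_def)

text \<open>A leading idempotent is absorbed by the product to its right. Idempotents at the end
  multiply to an idempotent by \<open>all_idle\<close> and are absorbed by the last remaining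
  factor.\<close>

lemma busy_props:
  assumes "cviable cs" "busy cs \<noteq> []"
  shows "cprod (busy cs) = cprod cs \<and> csrc (hd (busy cs)) = csrc (hd cs) \<and>
    ctgt (last (busy cs)) = ctgt (last cs) \<and> cviable (busy cs)"
  using assms
proof (induction cs rule: cprod.induct)
  case (3 c d cs)
  note v = cviable_Cons[OF 3(2)]
  have vd: "valid d" using v(1) by (simp add: cviable_def)
  show ?case
  proof (cases "busy (d # cs) = []")
    case True
    then have c: "\<not> idle c" and d: "idle d" using 3(3) by (auto split: if_splits)
    have "cprod (d # cs) = Some d" "ctgt (last (d # cs)) = ctgt d"
      using all_idle[OF v(1) True] by simp_all
    moreover have "ccomp c d = c" using ccomp_idle_right[OF d vd v(3)] .
    moreover have "ctgt d = ctgt c" using idle_valid[OF d vd] v(3) by (metis csrc.simps ctgt.simps)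
    moreover have "busy (c # d # cs) = [c]" using c True by simp
    moreover have "cviable [c]"
      using 3(2) v(2) unfolding cviable_def by (auto simp: add_leD1 intro: order_trans[rotated])
    ultimately show ?thesis using v(2) by (simp del: filter.simps)
  next
    case False
    have IH: "cprod (busy (d # cs)) = cprod (d # cs)" "csrc (hd (busy (d # cs))) = csrc d"
      "ctgt (last (busy (d # cs))) = ctgt (last (d # cs))" "cviable (busy (d # cs))"
      using 3(1)[OF v(1) False] by simp_all
    obtain d' cs' where busy: "busy (d # cs) = d' # cs'" using False by (cases "busy (d # cs)") auto
    show ?thesis
    proof (cases "idle c")
      case True
      have "cprod (c # d # cs) = cprod (d # cs)"
      proof (cases "cprod (d # cs)")
        case (Some e)
        have e: "valid e" "csrc e = csrc d" using cprod_Some[OF v(1) Some] by simp_all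
        then have "ccomp c e = e" using ccomp_idle_left[OF True v(2)] v(3) by simp
        then show ?thesis using Some e(1) by simp
      qed simp
      moreover have "csrc d = csrc c" using idle_valid[OF True v(2)] v(3) by (metis csrc.simps ctgt.simps)
      moreover have "busy (c # d # cs) = busy (d # cs)" using True by simp
      ultimately show ?thesis using IH by (simp del: cprod.simps filter.simps)
    next
      case c: False
      have b: "busy (c # d # cs) = c # d' # cs'" using c busy by simp
      have "covers (c # d' # cs') z \<le> 1" for z
        using 3(2) covers_busy[of "c # d # cs" z] b unfolding cviable_def by simp
      then have "cviable (c # d' # cs')"
        using IH(2,4) v(2,3) unfolding busy cviable_def by simp
      moreover have "cprod (c # d' # cs') = cprod (c # d # cs)"
        using IH(1) unfolding busy by simp
      ultimately show ?thesis
        unfolding b using IH(3) unfolding busy by simp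
    qed
  qed
qed (auto simp: cviable_def split: if_splits)

text \<open>Extensions start from a nonempty product, so one factor is kept when all of them are
  idempotents.\<close>

definition core :: "code list \<Rightarrow> code list" where
  "core cs = (if busy cs = [] then [hd cs] else busy cs)"

lemma core_props:
  assumes "cviable cs"
  shows "cprod (core cs) = cprod cs" "csrc (hd (core cs)) = csrc (hd cs)"
    "ctgt (last (core cs)) = ctgt (last cs)" "cviable (core cs)" "covers (core cs) = covers cs"
    "(\<forall>c\<in>set (core cs). tight c) \<longleftrightarrow> (\<forall>c\<in>set cs. tight c)"
proof -
  have "cprod (core cs) = cprod cs \<and> csrc (hd (core cs)) = csrc (hd cs) \<and>
    ctgt (last (core cs)) = ctgt (last cs) \<and> cviable (core cs) \<and> covers (core cs) = covers cs \<and>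
    ((\<forall>c\<in>set (core cs). tight c) \<longleftrightarrow> (\<forall>c\<in>set cs. tight c))"
  proof (cases "busy cs = []")
    case True
    have hd: "hd cs \<in> set cs" using assms by (simp add: cviable_def)
    then have idle: "\<forall>c\<in>set cs. idle c" using True by (simp add: filter_empty_conv)
    have "covers cs z = 0" for z using covers_busy[of cs z] True by simp
    moreover have "cover (hd cs) z = 0" for z using idle hd cover_idle by blast
    ultimately show ?thesis
      using all_idle[OF assms True] assms hd idle tight_idle True
      by (auto simp: core_def cviable_def fun_eq_iff)
  next
    case False
    have "(\<forall>c\<in>set (busy cs). tight c) \<longleftrightarrow> (\<forall>c\<in>set cs. tight c)"
      unfolding set_filter using tight_idle by blast
    then show ?thesis
      using busy_props[OF assms False] False covers_busy by (simp add: core_def fun_eq_iff)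
  qed
  then show "cprod (core cs) = cprod cs" "csrc (hd (core cs)) = csrc (hd cs)"
    "ctgt (last (core cs)) = ctgt (last cs)" "cviable (core cs)" "covers (core cs) = covers cs"
    "(\<forall>c\<in>set (core cs). tight c) \<longleftrightarrow> (\<forall>c\<in>set cs. tight c)"
    by blast+
qed

lemma ctightness_core: "cviable cs \<Longrightarrow> ctightness (core cs) \<tau> \<longleftrightarrow> ctightness cs \<tau>"
  by (cases \<tau>) (simp_all only: ctightness.simps core_props)

lemma dgm_idle: "dgm (s, Still, Still, s) = idem_diagram s"
proof -
  have "moving (select Still Still x) = {}" for x by (cases x) simp_all
  then show ?thesis by (simp add: dgm.simps idem_diagram_def moving_strands_def glue_def)
qed

text \<open>The prefix \<open>xs\<close>, in which all idempotents are already back in place, makes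
  the induction go through. Nonemptiness provides the neighbour that an extension needs.\<close>

lemma ext_contr_insert_idle:
  assumes "ext_contr L (map dgm (xs @ busy ys))" "xs @ busy ys \<noteq> []"
    "successively (\<lambda>c d. ctgt c = csrc d) (xs @ ys)" "\<forall>c\<in>set (xs @ ys). valid c"
  shows "ext_contr L (map dgm (xs @ ys))"
  using assms
proof (induction ys arbitrary: xs)
  case (Cons y ys)
  show ?case
  proof (cases "idle y")
    case False
    then show ?thesis using Cons.IH[of "xs @ [y]"] Cons.prems by simp
  next
    case True
    have y: "y = (csrc y, Still, Still, csrc y)" using idle_valid[OF True] Cons.prems(4) by simp
    have tgt_y: "ctgt y = csrc y" using y by (metis ctgt.simps)
    have chain: "successively (\<lambda>c d. ctgt c = csrc d) (xs @ ys)"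
      "xs \<noteq> [] \<Longrightarrow> ctgt (last xs) = csrc y" "ys \<noteq> [] \<Longrightarrow> csrc (hd ys) = csrc y"
      using Cons.prems(3) tgt_y by (auto simp: successively_append_iff successively_Cons)
    have val: "\<forall>c\<in>set xs. valid c" "\<forall>c\<in>set ys. valid c" using Cons.prems(4) by simp_all
    have "ext_contr L (map dgm (xs @ ys))"
      using Cons.IH[of xs] Cons.prems True chain(1) by simp
    then have 1: "ext_contr L (map dgm xs @ map dgm ys)" by simp
    have "xs @ ys \<noteq> []" using Cons.prems(2) True by auto
    then have "ext_contr L (map dgm xs @ [idem_diagram (csrc y)] @ map dgm ys)"
      using chain(2,3) val
      by (intro ext_contr.extension[OF 1]) (auto simp: last_map hd_map)
    moreover have "idem_diagram (csrc y) = dgm y" using dgm_idle[of "csrc y"] y by metis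
    ultimately show ?thesis by simp
  qed
qed simp

lemma ext_contr_core:
  assumes "cviable cs" "ext_contr L (map dgm (core cs))"
  shows "ext_contr L (map dgm cs)"
proof (cases "busy cs = []")
  case True
  obtain c ys where "cs = c # ys" using assms(1) by (cases cs) (auto simp: cviable_def)
  then show ?thesis
    using ext_contr_insert_idle[of L "[c]" ys] assms True
    by (simp add: core_def cviable_def split: if_splits)
next
  case False
  then show ?thesis
    using ext_contr_insert_idle[of L "[]" cs] assms
    by (simp add: core_def cviable_def)
qed

section \<open>The list\<close>

definition code_on :: "bool \<Rightarrow> place \<Rightarrow> motion \<Rightarrow> bool \<Rightarrow> code" where
  "code_on s x m t = (case x of PlaceP \<Rightarrow> (s, m, Still, t) | PlaceQ \<Rightarrow> (s, Still, m, t))"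

abbreviation "cpre x \<equiv> code_on False x Pre True"
abbreviation "cpost x \<equiv> code_on True x Post False"
abbreviation "ccr x \<equiv> code_on True x Long True"

lemma single_strand_eq_moving_strands:
  assumes "moving m = {(i, j)}"
  shows "{(pt x i, pt x j)} = moving_strands (case x of PlaceP \<Rightarrow> m | PlaceQ \<Rightarrow> Still)
    (case x of PlaceP \<Rightarrow> Still | PlaceQ \<Rightarrow> m)"
proof (rule set_eqI)
  fix z :: "point \<times> point"
  obtain u v where z: "z = (u, v)" by (cases z)
  have "(u, v) = (pt x i, pt x j) \<longleftrightarrow> interval u = x \<and> interval v = x \<and> (level_of u, level_of v) = (i, j)"
    using pt_interval_level_of by (metis Pair_inject interval_pt level_of_pt)
  then show "z \<in> {(pt x i, pt x j)} \<longleftrightarrow> z \<in> moving_strands (case x of PlaceP \<Rightarrow> m | PlaceQ \<Rightarrow> Still)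
      (case x of PlaceP \<Rightarrow> Still | PlaceQ \<Rightarrow> m)"
    unfolding z moving_strands_def glue_def
    by (cases x; cases "interval u"; cases "interval v") (auto simp: assms)
qed

lemma dgm_code_on:
  "dgm (code_on s x m t) = diag s (moving_strands (case x of PlaceP \<Rightarrow> m | PlaceQ \<Rightarrow> Still)
    (case x of PlaceP \<Rightarrow> Still | PlaceQ \<Rightarrow> m)) t"
  by (cases x) (simp_all add: code_on_def dgm.simps)

lemma dgm_named:
  "dgm (cpre x) = pre x" "dgm (cpost x) = post x" "dgm (ccr x) = cr x"
  unfolding dgm_code_on pre_def post_def cr_def
  using single_strand_eq_moving_strands[of Pre Bot Mid x] single_strand_eq_moving_strands[of Post Mid Top x]
    single_strand_eq_moving_strands[of Long Bot Top x]
  by simp_all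

definition clisted :: "place \<Rightarrow> place \<Rightarrow> (occupation \<times> bool \<times> bool \<times> tightness \<times> code list) list" where
  "clisted p q =
    [(Unoccupied, False, False, Tight, [(False, Still, Still, False)]),
     (Unoccupied, True, True, Tight, [(True, Still, Still, True)]),
     (PreOneHalf, False, True, Tight, [cpre p]),
     (PostOneHalf, True, False, Tight, [cpost p]),
     (Alternately, False, False, Singular, [cpre q, cpost p]),
     (Alternately, True, True, Tight, [cpost p, cpre q]),
     (Once, False, False, Tight, [cpre p, cpost p]),
     (Once, True, True, Twisted, [cpost p, cpre p]),
     (Once, True, True, Crossed, [ccr p]),
     (PreSesqui, False, True, Tight, [cpre p, cpost p, cpre q]),
     (PreSesqui, False, True, Sublime, [cpre q, ccr p]),
     (PreSesqui, False, True, Critical, [cpre q, cpost p, cpre p]),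
     (PostSesqui, True, False, Tight, [cpost q, cpre p, cpost p]),
     (PostSesqui, True, False, Sublime, [ccr p, cpost q]),
     (PostSesqui, True, False, Critical, [cpost p, cpre p, cpost q]),
     (Doubly, False, False, Tight, [cpre p, cpost p, cpre q, cpost q]),
     (Doubly, False, False, Sublime, [cpre p, ccr q, cpost p]),
     (Doubly, False, False, Critical, [cpre p, cpost q, cpre q, cpost p]),
     (Doubly, True, True, Tight, [cpost p, cpre q, cpost q, cpre p]),
     (Doubly, True, True, Sublime, [ccr q, cpost p, cpre p]),
     (Doubly, True, True, Sublime, [cpost p, cpre p, ccr q]),
     (Doubly, True, True, Crossed, [ccr p, ccr q]),
     (Doubly, True, True, Critical, [cpost p, cpre p, cpost q, cpre q])]"

lemma listed_eq: "listed p q = (\<lambda>(occ, s, t, \<tau>, cs). (occ, s, t, \<tau>, map dgm cs)) ` set (clisted p q)"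
  unfolding listed_def clisted_def by (simp add: dgm_named dgm_idle)

text \<open>
  A tight diagram is expanded into tight factors only: \<open>(True, Broken, Long, True)\<close>, for instance, is
  also a contraction of the sublime product of \<open>c\<^sub>q\<close>, \<open>p\<^sub>+\<close> and \<open>p\<^sub>-\<close>.
\<close>

definition expansions :: "(code \<times> code list) list" where
  "expansions = concat (map (\<lambda>(x, y).
    [(code_on False x Long False, [cpre x, cpost x]),
     (code_on True x Broken True, [cpost x, cpre x])]) [(PlaceP, PlaceQ), (PlaceQ, PlaceP)]) @
    [((False, Long, Long, False), [cpre PlaceP, cpost PlaceP, cpre PlaceQ, cpost PlaceQ]),
     ((False, Pre, Long, True), [cpre PlaceQ, cpost PlaceQ, cpre PlaceP]),
     ((False, Long, Pre, True), [cpre PlaceP, cpost PlaceP, cpre PlaceQ]),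
     ((True, Post, Long, False), [cpost PlaceP, cpre PlaceQ, cpost PlaceQ]),
     ((True, Long, Post, False), [cpost PlaceQ, cpre PlaceP, cpost PlaceP]),
     ((True, Post, Pre, True), [cpost PlaceP, cpre PlaceQ]),
     ((True, Pre, Post, True), [cpost PlaceQ, cpre PlaceP]),
     ((True, Broken, Long, True), [cpost PlaceP, cpre PlaceQ, cpost PlaceQ, cpre PlaceP]),
     ((True, Long, Broken, True), [cpost PlaceQ, cpre PlaceP, cpost PlaceP, cpre PlaceQ]),
     ((True, Long, Long, True), [ccr PlaceP, ccr PlaceQ])]"

text \<open>The codes without an entry are the two idempotents and the codes of the
  \<open>pre\<close>, \<open>post\<close> and \<open>cr\<close> diagrams, which stay as they
  are.\<close>

definition expand :: "code \<Rightarrow> code list" where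
  "expand c = (case map_of expansions c of None \<Rightarrow> [c] | Some cs \<Rightarrow> cs)"

lemma expand_code: "\<forall>c\<in>set codes. cprod (expand c) = Some c \<and> cviable (expand c)"
  by code_simp

text \<open>Each expansion multiplies to the code it replaces, which is nonzero, so contracting
  block after block recovers \<open>ys\<close>; \<open>xs\<close> collects the finished
  blocks.\<close>

lemma ext_contr_expand:
  assumes "ext_contr L (map dgm (xs @ concat (map expand ys)))" "\<forall>c\<in>set ys. valid c"
  shows "ext_contr L (map dgm (xs @ ys))"
  using assms
proof (induction ys arbitrary: xs)
  case (Cons y ys)
  have y: "valid y" "cprod (expand y) = Some y" "cviable (expand y)"
    using Cons.prems(2) bspec[OF expand_code, of y] by (simp_all add: set_codes)
  then have prod: "product (map dgm (expand y)) = dgm y" using product_dgm by simp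
  have "ext_contr L (map dgm xs @ map dgm (expand y) @ map dgm (concat (map expand ys)))"
    using Cons.prems(1) by simp
  then have "ext_contr L (map dgm xs @ [product (map dgm (expand y))] @ map dgm (concat (map expand ys)))"
    using y dgm_nonzero_iff[of y] prod by (intro ext_contr.contraction) (auto simp: cviable_def)
  then show ?case
    using Cons.IH[of "xs @ [y]"] Cons.prems(2) by (simp add: prod)
qed simp

section \<open>Enumeration of all tensor products without idempotents\<close>

fun occupied :: "place \<Rightarrow> place \<Rightarrow> (step \<Rightarrow> nat) \<Rightarrow> occupation \<Rightarrow> bool" where
  "occupied p q h Unoccupied \<longleftrightarrow> unocc h p \<and> unocc h q"
| "occupied p q h PreOneHalf \<longleftrightarrow> pre_half h p \<and> unocc h q"
| "occupied p q h PostOneHalf \<longleftrightarrow> post_half h p \<and> unocc h q"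
| "occupied p q h Alternately \<longleftrightarrow> half h p \<and> half h q"
| "occupied p q h Once \<longleftrightarrow> full h p \<and> unocc h q"
| "occupied p q h PreSesqui \<longleftrightarrow> full h p \<and> pre_half h q"
| "occupied p q h PostSesqui \<longleftrightarrow> full h p \<and> post_half h q"
| "occupied p q h Doubly \<longleftrightarrow> full h p \<and> full h q"

lemma occupied_imp_has_occupation:
  assumes "p \<noteq> q" "occupied p q h occ"
  shows "has_occupation h occ"
proof -
  have "x = p \<or> x = q" for x using assms(1) by (cases x; cases p; cases q) auto
  then show ?thesis using assms by (cases occ) (simp_all, metis+)
qed

text \<open>The expansion must equal a listed product literally. Occupation and tightness are tested
  on \<open>cs\<close> itself and not on its expansion, because a contraction may change the
  tightness, for instance from sublime to tight.\<close>

definition on_list :: "code list \<Rightarrow> bool" where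
  "on_list cs \<longleftrightarrow> (let L = concat (map expand cs); e = cprod cs in
     \<exists>(p, q)\<in>set [(PlaceP, PlaceQ), (PlaceQ, PlaceP)]. \<exists>(occ, s, t, \<tau>, M)\<in>set (clisted p q).
       M = L \<and> s = csrc (hd cs) \<and> t = ctgt (last cs) \<and>
       occupied p q (covers cs) occ \<and> ctightness cs \<tau>)"

text \<open>The vector \<open>u\<close> records how often each step is covered so far and prunes the
  search; \<open>n\<close> bounds the number of factors. All shorter words are listed too, including
  the empty one.\<close>

fun words :: "nat \<Rightarrow> nat list \<Rightarrow> bool \<Rightarrow> code list list" where
  "words 0 u s = [[]]"
| "words (Suc n) u s = [] # concat (map (\<lambda>c. map ((#) c) (words n (map2 (+) u (map (cover c) steps)) (ctgt c)))
     (filter (\<lambda>c. csrc c = s \<and> \<not> idle c \<and> list_all (\<lambda>k. k \<le> 1) (map2 (+) u (map (cover c) steps))) codes))"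

text \<open>The vector grows along the recursion, hence the arbitrary initial covering
  \<open>h\<close>.\<close>

lemma mem_words:
  assumes "length cs \<le> n" "\<forall>c\<in>set cs. valid c \<and> \<not> idle c" "successively (\<lambda>c d. ctgt c = csrc d) cs"
    "cs \<noteq> [] \<Longrightarrow> csrc (hd cs) = s" "\<forall>z. h z + covers cs z \<le> 1"
  shows "cs \<in> set (words n (map h steps) s)"
  using assms
proof (induction n arbitrary: cs s h)
  case (Suc n)
  show ?case
  proof (cases cs)
    case (Cons c ds)
    let ?h = "\<lambda>z. h z + cover c z"
    have "ds \<in> set (words n (map ?h steps) (ctgt c))"
    proof (rule Suc.IH)
      show "ds \<noteq> [] \<Longrightarrow> csrc (hd ds) = ctgt c"
        using Suc.prems(3) Cons by (cases ds) simp_all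
      show "successively (\<lambda>c d. ctgt c = csrc d) ds"
        using Suc.prems(3) Cons by (cases ds) simp_all
      show "\<forall>z. ?h z + covers ds z \<le> 1" using Suc.prems(5) Cons by (simp add: add.assoc)
    qed (use Suc.prems Cons in simp_all)
    moreover have map2: "map2 (+) (map h steps) (map (cover c) steps) = map ?h steps"
      by (simp add: steps_def)
    moreover have "?h z \<le> 1" for z using Suc.prems(5) Cons by (metis add.assoc add_leD1 covers_simps(2))
    then have "list_all (\<lambda>k. k \<le> 1) (map2 (+) (map h steps) (map (cover c) steps))"
      unfolding map2 by (simp add: list_all_iff)
    moreover have "c \<in> set codes" "csrc c = s" "\<not> idle c"
      using Suc.prems(2,4) Cons by (simp_all add: set_codes)
    ultimately show ?thesis
      using Cons by (auto simp del: split_paired_Ex intro!: exI[of _ c])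
  qed simp
qed simp

text \<open>Each factor that is not an idempotent covers some step. With four steps covered at most
  once this yields the bound 4 in \<open>words_code\<close>.\<close>

lemma length_le_covers:
  assumes "\<forall>c\<in>set cs. \<not> idle c"
  shows "length cs \<le> (\<Sum>z\<leftarrow>steps. covers cs z)"
  using assms
proof (induction cs)
  case (Cons c cs)
  obtain s a b t where c: "c = (s, a, b, t)" by (cases c)
  have "1 \<le> (\<Sum>z\<leftarrow>steps. cover c z)"
    using Cons.prems by (cases a; cases b) (auto simp: c steps_def num.simps)
  then show ?case using Cons by (simp add: steps_def)
qed simp

text \<open>The classification proper, by evaluation over all words that start at either idempotent
  with no step covered yet.\<close>

lemma words_code: "\<forall>s\<in>set [False, True]. \<forall>cs\<in>set (words 4 [0, 0, 0, 0] s). cs = [] \<or> on_list cs"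
  by code_simp

lemma idle_on_list_code: "\<forall>s\<in>set [False, True]. on_list [(s, Still, Still, s)]"
  by code_simp

lemma on_list_core:
  assumes "cviable cs"
  shows "on_list (core cs)"
proof (cases "busy cs = []")
  case True
  have "hd cs \<in> set cs" using assms by (simp add: cviable_def)
  then have "idle (hd cs)" "valid (hd cs)"
    using True assms by (simp_all add: filter_empty_conv cviable_def)
  then have "core cs = [(csrc (hd cs), Still, Still, csrc (hd cs))]"
    using idle_valid True by (simp add: core_def)
  moreover have "csrc (hd cs) \<in> set [False, True]" by auto
  ultimately show ?thesis using idle_on_list_code by metis
next
  case False
  then have core: "core cs = busy cs" by (simp add: core_def)
  have v: "cviable (busy cs)" using core_props(4)[OF assms] core by simp
  have le1: "covers (busy cs) z \<le> 1" for z using v by (simp add: cviable_def)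
  have "length (busy cs) \<le> (\<Sum>z\<leftarrow>steps. covers (busy cs) z)"
    by (rule length_le_covers) simp
  also have "\<dots> \<le> 4"
    using le1[of "Before PlaceP"] le1[of "After PlaceP"] le1[of "Before PlaceQ"] le1[of "After PlaceQ"]
    by (simp add: steps_def)
  finally have "busy cs \<in> set (words 4 (map (\<lambda>z. 0) steps) (csrc (hd (busy cs))))"
    using v le1 by (intro mem_words) (auto simp: cviable_def)
  moreover have "map (\<lambda>z. 0) steps = [0, 0, 0, 0 :: nat]" by (simp add: steps_def)
  moreover have "csrc (hd (busy cs)) \<in> set [False, True]" by auto
  ultimately show ?thesis using words_code False core by metis
qed

theorem proposition4p17:
  fixes D :: "element list" and h :: "step \<Rightarrow> nat" and s t :: bool
  assumes "viable D" and "tensor_hdata D = (h, s, t)"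
  shows "\<exists>p q occ \<tau> L. p \<noteq> q \<and> (occ, s, t, \<tau>, L) \<in> listed p q \<and> ext_contr L D \<and>
           has_occupation h occ \<and> has_tightness D \<tau>"
proof -
  obtain cs where D: "D = map dgm cs" and cs: "cviable cs"
    using viable_imp_cviable[OF assms(1)] .
  have hst: "h = covers cs" "s = csrc (hd cs)" "t = ctgt (last cs)"
    using assms(2) tensor_hdata_dgm[OF cs] by (simp_all add: D)
  note core = core_props[OF cs]
  \<comment> \<open>Omitting idempotents and expanding the other factors produces the listed
    product; extensions and contractions lead back to \<open>D\<close>.\<close>
  let ?L = "concat (map expand (core cs))"
  obtain p q occ \<tau> where pq: "p \<noteq> q"
    and listed: "(occ, csrc (hd (core cs)), ctgt (last (core cs)), \<tau>, ?L) \<in> set (clisted p q)"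
    and occ: "occupied p q (covers (core cs)) occ" and \<tau>: "ctightness (core cs) \<tau>"
    using on_list_core[OF cs] unfolding on_list_def Let_def by fastforce
  have "(occ, s, t, \<tau>, map dgm ?L) \<in> listed p q"
    unfolding listed_eq hst core(2,3)[symmetric] by (rule image_eqI[OF _ listed]) simp
  moreover have "ext_contr (map dgm ?L) D"
    unfolding D using ext_contr_expand[of "map dgm ?L" "[]" "core cs"] core(4)
    by (intro ext_contr_core[OF cs]) (simp add: ext_contr.refl cviable_def)
  moreover have "has_occupation h occ"
    using occupied_imp_has_occupation[OF pq occ] by (simp add: hst core(5))
  moreover have "has_tightness D \<tau>"
    unfolding D using has_tightness_dgm[OF cs] \<tau> ctightness_core[OF cs] by simp
  ultimately show ?thesis using pq by blast
qed

end
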